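(* Let $$G=\bigl\{w=(w_1,w_2,w_3,w_4)\in\mathbb{C}^4:\ |w_1|^2+|w_2|^2+|w_3|^2+|w_4|^2<1,\ w_1w_4=w_2w_3\bigr\},$$ a relatively compact domain in the algebraic variety $V=\{w\in\mathbb{C}^4: w_1w_4=w_2w_3\}$. Then $G$ is not biholomorphic to any finite ball quotient.
   Context: A finite ball quotient is a quotient $\mathbb{B}^n/\Gamma$ of the unit ball $\mathbb{B}^n\subset\mathbb{C}^n$ by a finite subgroup $\Gamma$ of its holomorphic automorphism group $\operatorname{Aut}(\mathbb{B}^n)$ (up to conjugation, $\Gamma\subset U(n)$), with its natural structure of normal complex space. *)

theory Defs
  imports "HOL-Analysis.Analysis" "HOL-Algebra.Group_Action"
begin

section \<open>Holomorphic functions and maps of several variables\<close>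

text \<open>
  A function is holomorphic on an open set if it is complex differentiable there, i.e. if its
  real Frechet derivative exists and is \<open>\<complex>\<close>-linear at each point. (The scalar action of
  \<open>\<complex>\<close> on \<open>\<complex>\<^sup>n\<close> is \<open>(*s)\<close>.) Both notions are only meant to be used for open \<open>U\<close>; on open \<open>U\<close>
  they do not depend on values outside \<open>U\<close>.
\<close>

definition holo_fun_on :: "(complex^'n \<Rightarrow> complex) \<Rightarrow> (complex^'n) set \<Rightarrow> bool" where
  "holo_fun_on f U \<longleftrightarrow>
     (\<forall>x\<in>U. \<exists>D. (f has_derivative D) (at x) \<and> (\<forall>c v. D (c *s v) = c * D v))"

definition holo_map_on :: "(complex^'n \<Rightarrow> complex^'m) \<Rightarrow> (complex^'n) set \<Rightarrow> bool" where
  "holo_map_on F U \<longleftrightarrow>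
     (\<forall>x\<in>U. \<exists>D. (F has_derivative D) (at x) \<and> (\<forall>c v. D (c *s v) = c *s D v))"

lemma holo_map_on_cong:
  assumes "open U" "\<And>x. x \<in> U \<Longrightarrow> F x = F' x" "holo_map_on F U"
  shows "holo_map_on F' U"
  using assms unfolding holo_map_on_def
  by (metis has_derivative_transform_within_open)

lemma holo_map_on_compose:
  assumes "holo_map_on F U" "holo_map_on H W" "F ` U \<subseteq> W"
  shows "holo_map_on (\<lambda>x. H (F x)) U"
  unfolding holo_map_on_def
proof
  fix x assume x: "x \<in> U"
  obtain D where D: "(F has_derivative D) (at x)" "\<forall>c v. D (c *s v) = c *s D v"
    using assms(1) x unfolding holo_map_on_def by blast
  obtain E where E: "(H has_derivative E) (at (F x))" "\<forall>c v. E (c *s v) = c *s E v"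
    using assms(2,3) x unfolding holo_map_on_def by blast
  have "((\<lambda>x. H (F x)) has_derivative (\<lambda>v. E (D v))) (at x)"
    using has_derivative_compose[OF D(1) E(1)] .
  then show "\<exists>D. ((\<lambda>x. H (F x)) has_derivative D) (at x) \<and> (\<forall>c v. D (c *s v) = c *s D v)"
    using D(2) E(2) by (intro exI[of _ "\<lambda>v. E (D v)"]) simp
qed

lemma holo_map_on_iff_components:
  fixes F :: "complex^'n \<Rightarrow> complex^'m"
  shows "holo_map_on F U \<longleftrightarrow> (\<forall>i. holo_fun_on (\<lambda>x. F x $ i) U)"
proof
  assume F: "holo_map_on F U"
  show "\<forall>i. holo_fun_on (\<lambda>x. F x $ i) U"
    unfolding holo_fun_on_def
  proof (intro allI ballI)
    fix i x assume "x \<in> U"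
    then obtain D where D: "(F has_derivative D) (at x)" "\<forall>c v. D (c *s v) = c *s D v"
      using F unfolding holo_map_on_def by blast
    have "((\<lambda>x. F x $ i) has_derivative (\<lambda>v. D v $ i)) (at x)"
      using bounded_linear.has_derivative[OF bounded_linear_vec_nth D(1)] .
    then show "\<exists>D. ((\<lambda>x. F x $ i) has_derivative D) (at x) \<and> (\<forall>c v. D (c *s v) = c * D v)"
      using D(2) by (intro exI[of _ "\<lambda>v. D v $ i"]) simp
  qed
next
  assume F: "\<forall>i. holo_fun_on (\<lambda>x. F x $ i) U"
  show "holo_map_on F U"
    unfolding holo_map_on_def
  proof
    fix x assume "x \<in> U"
    then have "\<forall>i. \<exists>D. ((\<lambda>x. F x $ i) has_derivative D) (at x) \<and> (\<forall>c v. D (c *s v) = c * D v)"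
      using F unfolding holo_fun_on_def by blast
    then obtain D where
      D: "\<And>i. ((\<lambda>x. F x $ i) has_derivative D i) (at x)" "\<And>i c v. D i (c *s v) = c * D i v"
      by metis
    have "bounded_linear (axis i :: complex \<Rightarrow> complex^'m)" for i
      unfolding linear_conv_bounded_linear[symmetric]
      by (rule linearI) (auto simp: axis_def vec_eq_iff)
    from bounded_linear.has_derivative[OF this D(1)]
    have "((\<lambda>x. \<Sum>i\<in>UNIV. axis i (F x $ i)) has_derivative
        (\<lambda>v. \<Sum>i\<in>UNIV. axis i (D i v))) (at x)"
      by (rule has_derivative_sum)
    moreover have "(\<Sum>i\<in>UNIV. axis i (f i)) = (\<chi> i. f i)" for f :: "'m \<Rightarrow> complex"
      by (simp add: vec_eq_iff axis_def if_distrib cong: if_cong)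
    ultimately have "(F has_derivative (\<lambda>v. \<chi> i. D i v)) (at x)"
      by simp
    moreover have "(\<chi> i. D i (c *s v)) = c *s (\<chi> i. D i v)" for c v
      by (simp add: vec_eq_iff D(2))
    ultimately show "\<exists>D. (F has_derivative D) (at x) \<and> (\<forall>c v. D (c *s v) = c *s D v)"
      by blast
  qed
qed


section \<open>Complex spaces as spaces with a sheaf of functions\<close>

text \<open>
  A reduced complex space is encoded by its underlying topological space together with its
  structure sheaf, seen as a sheaf of complex-valued functions: \<open>hol_funs X U\<close> is the set of
  (total) functions whose restriction to the open set \<open>U\<close> is holomorphic. For reduced spaces a
  holomorphic map is the same as a continuous map pulling holomorphic functions back to
  holomorphic functions.
\<close>

record 'a function_space =
  space_top :: "'a topology"
  hol_funs :: "'a set \<Rightarrow> ('a \<Rightarrow> complex) set"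

definition holomorphic_map ::
    "'a function_space \<Rightarrow> 'b function_space \<Rightarrow> ('a \<Rightarrow> 'b) \<Rightarrow> bool" where
  "holomorphic_map X Y \<phi> \<longleftrightarrow>
     continuous_map (space_top X) (space_top Y) \<phi> \<and>
     (\<forall>V f. openin (space_top Y) V \<and> f \<in> hol_funs Y V \<longrightarrow>
        (\<lambda>x. f (\<phi> x)) \<in> hol_funs X {x \<in> topspace (space_top X). \<phi> x \<in> V})"

definition biholomorphic :: "'a function_space \<Rightarrow> 'b function_space \<Rightarrow> bool" where
  "biholomorphic X Y \<longleftrightarrow>
     (\<exists>\<phi> \<psi>. holomorphic_map X Y \<phi> \<and> holomorphic_map Y X \<psi> \<and>
        (\<forall>x \<in> topspace (space_top X). \<psi> (\<phi> x) = x) \<and>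
        (\<forall>y \<in> topspace (space_top Y). \<phi> (\<psi> y) = y))"

text \<open>
  The reduced complex structure on a locally analytic subset \<open>A\<close> of \<open>\<complex>\<^sup>m\<close>: holomorphic functions
  are those that locally extend to holomorphic functions of the ambient variables.
\<close>

definition embedded_space :: "(complex^'m) set \<Rightarrow> (complex^'m) function_space" where
  "embedded_space A =
     \<lparr>space_top = top_of_set A,
      hol_funs = (\<lambda>U. {f. \<forall>p\<in>U. \<exists>W F. open W \<and> p \<in> W \<and> holo_fun_on F W \<and>
                                   (\<forall>w \<in> W \<inter> U. f w = F w)})\<rparr>"


section \<open>Finite ball quotients\<close>

text \<open>
  As in \<^const>\<open>BijGroup\<close>, automorphisms are represented by extensional functions, so
  that distinct elements of the group are distinct as maps on \<open>D\<close>.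
\<close>

definition hol_auts :: "(complex^'n) set \<Rightarrow> (complex^'n \<Rightarrow> complex^'n) set" where
  "hol_auts D = {F \<in> Bij D. holo_map_on F D \<and> holo_map_on (inv_into D F) D}"

definition HolAut :: "(complex^'n) set \<Rightarrow> (complex^'n \<Rightarrow> complex^'n) monoid" where
  "HolAut D = (BijGroup D)\<lparr>carrier := hol_auts D\<rparr>"

abbreviation unit_ball :: "(complex^'n) set" where
  "unit_ball \<equiv> ball 0 1"

lemma subgroup_hol_auts:
  assumes "open D"
  shows "subgroup (hol_auts D) (BijGroup D)"
proof (rule group.subgroupI[OF group_BijGroup])
  show "hol_auts D \<subseteq> carrier (BijGroup D)"
    by (auto simp: hol_auts_def BijGroup_def)
  have id: "holo_map_on (\<lambda>x. x) D"
    unfolding holo_map_on_def by (intro ballI exI[of _ "\<lambda>v. v"]) auto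
  have "x = inv_into D (\<lambda>x\<in>D. x) x" if "x \<in> D" for x
    using inv_into_f_f[of "\<lambda>x\<in>D. x" D x] that by (simp add: inj_on_def)
  then have "holo_map_on (inv_into D (\<lambda>x\<in>D. x)) D"
    by (rule holo_map_on_cong[OF assms _ id])
  moreover have "holo_map_on (\<lambda>x\<in>D. x) D"
    by (rule holo_map_on_cong[OF assms _ id]) simp
  ultimately have "(\<lambda>x\<in>D. x) \<in> hol_auts D"
    using id_Bij by (simp add: hol_auts_def)
  then show "hol_auts D \<noteq> {}" by blast
next
  fix a assume a: "a \<in> hol_auts D"
  then have aB: "a \<in> Bij D" and h: "holo_map_on a D" "holo_map_on (inv_into D a) D"
    by (auto simp: hol_auts_def)
  have b: "bij_betw a D D" using aB by (simp add: Bij_def)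
  let ?i = "\<lambda>x\<in>D. inv_into D a x"
  have inv: "inv\<^bsub>BijGroup D\<^esub> a = ?i" using inv_BijGroup[OF aB] .
  have iB: "?i \<in> Bij D" using restrict_inv_into_Bij[OF aB] .
  then have bi: "bij_betw ?i D D" by (simp add: Bij_def)
  have "holo_map_on ?i D"
    by (rule holo_map_on_cong[OF assms _ h(2)]) simp
  moreover have "a x = inv_into D ?i x" if "x \<in> D" for x
  proof -
    have ax: "a x \<in> D" using b that by (auto simp: bij_betw_def)
    have "?i (a x) = x" using ax b that by (simp add: bij_betw_def)
    then show ?thesis using ax bi by (metis bij_betw_def inv_into_f_f)
  qed
  then have "holo_map_on (inv_into D ?i) D"
    by (rule holo_map_on_cong[OF assms _ h(1)])
  ultimately show "inv\<^bsub>BijGroup D\<^esub> a \<in> hol_auts D"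
    using iB by (simp add: inv hol_auts_def)
next
  fix a b assume a: "a \<in> hol_auts D" and b: "b \<in> hol_auts D"
  then have aB: "a \<in> Bij D" and ha: "holo_map_on a D" "holo_map_on (inv_into D a) D"
    and bB: "b \<in> Bij D" and hb: "holo_map_on b D" "holo_map_on (inv_into D b) D"
    by (auto simp: hol_auts_def)
  have ba: "bij_betw a D D" and bb: "bij_betw b D D" using aB bB by (auto simp: Bij_def)
  have cB: "compose D a b \<in> Bij D" by (rule compose_Bij[OF aB bB])
  then have bc: "bij_betw (compose D a b) D D" by (simp add: Bij_def)
  have im: "b ` D \<subseteq> D" "inv_into D a ` D \<subseteq> D"
    using bb bij_betw_inv_into[OF ba] by (auto simp: bij_betw_def)
  have "holo_map_on (compose D a b) D"
    by (rule holo_map_on_cong[OF assms _ holo_map_on_compose[OF hb(1) ha(1) im(1)]])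
       (simp add: compose_def)
  moreover have "inv_into D b (inv_into D a x) = inv_into D (compose D a b) x" if x: "x \<in> D" for x
  proof -
    let ?y = "inv_into D b (inv_into D a x)"
    have ax: "inv_into D a x \<in> D" using im x by auto
    have y: "?y \<in> D" using bij_betw_inv_into[OF bb] ax by (auto simp: bij_betw_def)
    have "b ?y = inv_into D a x" "a (inv_into D a x) = x"
      using ax x ba bb by (simp_all add: bij_betw_def f_inv_into_f)
    then have "compose D a b ?y = x" using y by (simp add: compose_def)
    then show ?thesis using y bc by (metis bij_betw_def inv_into_f_f)
  qed
  then have "holo_map_on (inv_into D (compose D a b)) D"
    by (rule holo_map_on_cong[OF assms _ holo_map_on_compose[OF ha(2) hb(2) im(2)]])
  ultimately show "a \<otimes>\<^bsub>BijGroup D\<^esub> b \<in> hol_auts D"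
    using aB bB cB by (simp add: hol_auts_def BijGroup_def)
qed

lemma group_HolAut:
  assumes "open D" shows "group (HolAut D)"
  unfolding HolAut_def
  by (rule subgroup.subgroup_is_group[OF subgroup_hol_auts[OF assms] group_BijGroup])

lemma group_action_HolAut:
  assumes "open D" "subgroup \<Gamma> (HolAut D)"
  shows "group_action ((HolAut D)\<lparr>carrier := \<Gamma>\<rparr>) D (\<lambda>g. g)"
proof -
  have "group ((HolAut D)\<lparr>carrier := \<Gamma>\<rparr>)"
    by (rule subgroup.subgroup_is_group[OF assms(2) group_HolAut[OF assms(1)]])
  moreover have "\<Gamma> \<subseteq> Bij D"
    using subgroup.subset[OF assms(2)] by (auto simp: HolAut_def hol_auts_def)
  ultimately show ?thesis
    unfolding group_action_def group_hom_def group_hom_axioms_def hom_def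
    using group_BijGroup by (auto simp: HolAut_def BijGroup_def)
qed

definition ball_orbit :: "(complex^'n \<Rightarrow> complex^'n) set \<Rightarrow> complex^'n \<Rightarrow> (complex^'n) set" where
  "ball_orbit \<Gamma> = orbit ((HolAut unit_ball)\<lparr>carrier := \<Gamma>\<rparr>) (\<lambda>g. g)"

definition ball_orbits :: "(complex^'n \<Rightarrow> complex^'n) set \<Rightarrow> (complex^'n) set set" where
  "ball_orbits \<Gamma> = orbits ((HolAut unit_ball)\<lparr>carrier := \<Gamma>\<rparr>) unit_ball (\<lambda>g. g)"

definition ball_quotient_topology ::
    "(complex^'n \<Rightarrow> complex^'n) set \<Rightarrow> (complex^'n) set topology" where
  "ball_quotient_topology \<Gamma> =
     topology (\<lambda>U. U \<subseteq> ball_orbits \<Gamma> \<and> open {z \<in> unit_ball. ball_orbit \<Gamma> z \<in> U})"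

text \<open>
  The structure sheaf of the quotient is the sheaf of \<open>\<Gamma>\<close>-invariant holomorphic functions
  (Cartan); for finite \<open>\<Gamma>\<close> it makes the quotient a normal complex space.
\<close>

definition ball_quotient ::
    "(complex^'n \<Rightarrow> complex^'n) set \<Rightarrow> (complex^'n) set function_space" where
  "ball_quotient \<Gamma> =
     \<lparr>space_top = ball_quotient_topology \<Gamma>,
      hol_funs = (\<lambda>U. {f. holo_fun_on (\<lambda>z. f (ball_orbit \<Gamma> z))
                            {z \<in> unit_ball. ball_orbit \<Gamma> z \<in> U}})\<rparr>"

lemma openin_ball_quotient_topology:
  fixes \<Gamma> :: "(complex^'n \<Rightarrow> complex^'n) set"
  shows "openin (ball_quotient_topology \<Gamma>) U \<longleftrightarrow>
     U \<subseteq> ball_orbits \<Gamma> \<and> open {z \<in> unit_ball. ball_orbit \<Gamma> z \<in> U}"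
proof -
  have "istopology (\<lambda>U. U \<subseteq> ball_orbits \<Gamma> \<and> open {z \<in> unit_ball. ball_orbit \<Gamma> z \<in> U})"
    unfolding istopology_def
  proof (intro conjI allI impI)
    fix S T :: "(complex^'n) set set"
    assume S: "S \<subseteq> ball_orbits \<Gamma> \<and> open {z \<in> unit_ball. ball_orbit \<Gamma> z \<in> S}"
      and T: "T \<subseteq> ball_orbits \<Gamma> \<and> open {z \<in> unit_ball. ball_orbit \<Gamma> z \<in> T}"
    show "S \<inter> T \<subseteq> ball_orbits \<Gamma>" using S by blast
    have "{z \<in> unit_ball. ball_orbit \<Gamma> z \<in> S \<inter> T} =
        {z \<in> unit_ball. ball_orbit \<Gamma> z \<in> S} \<inter> {z \<in> unit_ball. ball_orbit \<Gamma> z \<in> T}" by blast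
    then show "open {z \<in> unit_ball. ball_orbit \<Gamma> z \<in> S \<inter> T}"
      using open_Int[OF conjunct2[OF S] conjunct2[OF T]] by (rule ssubst)
  next
    fix K :: "(complex^'n) set set set"
    assume K: "\<forall>S\<in>K. S \<subseteq> ball_orbits \<Gamma> \<and> open {z \<in> unit_ball. ball_orbit \<Gamma> z \<in> S}"
    show "\<Union> K \<subseteq> ball_orbits \<Gamma>" using K by blast
    have "{z \<in> unit_ball. ball_orbit \<Gamma> z \<in> \<Union> K} =
        (\<Union>S\<in>K. {z \<in> unit_ball. ball_orbit \<Gamma> z \<in> S})" by blast
    moreover have "open (\<Union>S\<in>K. {z \<in> unit_ball. ball_orbit \<Gamma> z \<in> S})"
      by (rule open_UN) (use K in blast)
    ultimately show "open {z \<in> unit_ball. ball_orbit \<Gamma> z \<in> \<Union> K}"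
      by (rule ssubst)
  qed
  then show ?thesis
    by (simp add: ball_quotient_topology_def)
qed

lemma topspace_ball_quotient_topology:
  "topspace (ball_quotient_topology \<Gamma>) = ball_orbits \<Gamma>"
proof -
  have "{z \<in> unit_ball. ball_orbit \<Gamma> z \<in> ball_orbits \<Gamma>} = unit_ball"
    by (auto simp: ball_orbits_def ball_orbit_def orbits_def)
  then have "openin (ball_quotient_topology \<Gamma>) (ball_orbits \<Gamma>)"
    by (simp add: openin_ball_quotient_topology)
  then show ?thesis
    using openin_subset openin_topspace openin_ball_quotient_topology
    by (metis (no_types, lifting) subset_antisym)
qed

lemma quotient_map_ball_orbit:
  fixes \<Gamma> :: "(complex^'n \<Rightarrow> complex^'n) set"
  shows "quotient_map (top_of_set unit_ball) (ball_quotient_topology \<Gamma>) (ball_orbit \<Gamma>)"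
proof -
  have "openin (top_of_set unit_ball) {z \<in> unit_ball. P z} \<longleftrightarrow> open {z \<in> unit_ball. P z}"
    for P :: "complex^'n \<Rightarrow> bool"
    by (subst openin_open_eq) auto
  moreover have "ball_orbit \<Gamma> ` unit_ball = ball_orbits \<Gamma>"
    by (auto simp: ball_orbits_def ball_orbit_def orbits_def)
  ultimately show ?thesis
    unfolding quotient_map_def topspace_ball_quotient_topology openin_ball_quotient_topology
    by simp
qed


section \<open>The domain in the quadric cone\<close>

definition quadric_cone :: "(complex^4) set" where
  "quadric_cone = {w. w $ 1 * w $ 4 = w $ 2 * w $ 3}"

definition cone_domain :: "(complex^4) set" where
  "cone_domain = {w. (cmod (w $ 1))\<^sup>2 + (cmod (w $ 2))\<^sup>2 + (cmod (w $ 3))\<^sup>2 + (cmod (w $ 4))\<^sup>2 < 1 \<and>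
                     w $ 1 * w $ 4 = w $ 2 * w $ 3}"

lemma cone_domain_eq: "cone_domain = unit_ball \<inter> quadric_cone"
proof -
  have "norm w < 1 \<longleftrightarrow>
      (cmod (w $ 1))\<^sup>2 + (cmod (w $ 2))\<^sup>2 + (cmod (w $ 3))\<^sup>2 + (cmod (w $ 4))\<^sup>2 < 1"
    for w :: "complex^4"
    by (simp add: norm_vec_def L2_set_def sum_4)
  then show ?thesis
    by (simp only: set_eq_iff Int_iff mem_ball_0 mem_Collect_eq cone_domain_def quadric_cone_def)
       blast
qed

lemma cone_domain_relatively_compact_domain:
  shows "openin (top_of_set quadric_cone) cone_domain"
    and "connected cone_domain"
    and "cone_domain \<noteq> {}"
    and "compact (closure cone_domain)" "closure cone_domain \<subseteq> quadric_cone"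
proof -
  show "openin (top_of_set quadric_cone) cone_domain"
    unfolding cone_domain_eq by (auto simp: openin_open)
  have "starlike cone_domain"
    unfolding starlike_def
  proof (intro bexI[of _ 0] ballI subsetI)
    show "0 \<in> cone_domain" by (simp add: cone_domain_def)
    fix w x assume w: "w \<in> cone_domain" and "x \<in> closed_segment 0 w"
    then obtain t where t: "0 \<le> t" "t \<le> 1" "x = t *\<^sub>R w" by (auto simp: in_segment)
    have "norm x \<le> norm w" using t by (simp add: mult_left_le_one_le)
    then show "x \<in> cone_domain"
      using w t by (simp add: cone_domain_eq quadric_cone_def)
  qed
  then show "connected cone_domain" "cone_domain \<noteq> {}"
    using starlike_imp_connected by (blast, auto simp: starlike_def)
  show "compact (closure cone_domain)"
    unfolding compact_closure cone_domain_eq by (meson bounded_Int bounded_ball)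
  have "closed quadric_cone"
    unfolding quadric_cone_def by (intro closed_Collect_eq continuous_intros)
  then show "closure cone_domain \<subseteq> quadric_cone"
    by (intro closure_minimal) (auto simp: cone_domain_eq)
qed

end

theory Submission
  imports Defs "HOL-Complex_Analysis.Complex_Analysis" "HOL-Computational_Algebra.Field_as_Ring"
    "HOL-Computational_Algebra.Fundamental_Theorem_Algebra" "Jordan_Normal_Form.Determinant"
begin

text \<open>
  Composing a biholomorphism with the quotient map of the ball gives a holomorphic map \<open>f\<close> from the
  ball of \<open>\<complex>\<^sup>n\<close> onto the domain in the cone, with finite fibres and \<open>f\<^sub>1 f\<^sub>4 = f\<^sub>2 f\<^sub>3\<close>. Its image is not
  negligible under the projection to \<open>(w\<^sub>1, w\<^sub>2, w\<^sub>3)\<close>, so \<open>n \<ge> 3\<close>. In a unique factorisation domain of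
  germs one would write \<open>f = (da, db, ae, be)\<close> and observe that \<open>f\<close> vanishes exactly
  where \<open>a = b = 0\<close> or \<open>d = e = 0\<close>, which are sets without isolated points.

  Factorisation of germs is avoided by slicing. On a suitable three-dimensional slice, for
  \<open>p \<in> \<complex>\<^sup>2\<close> near \<open>0\<close> the function \<open>f\<^sub>1(p, \<cdot>)\<close> has a constant number \<open>N\<close> of zeros in a disc. For \<open>p \<noteq> 0\<close> they are
  distributed as \<open>k\<close> poles of \<open>f\<^sub>2 / f\<^sub>1\<close> and \<open>N - k\<close> poles of \<open>f\<^sub>3 / f\<^sub>1\<close>, because the \<open>f\<^sub>i\<close> have no common
  zero there. Poles are detected by Hankel determinants of moments \<open>\<ointegral> g(z) z\<^sup>m dz\<close>, which are
  holomorphic in \<open>p\<close>: exactly one \<open>k\<close> makes the product of the \<open>k\<close>-th determinant of \<open>f\<^sub>2 / f\<^sub>1\<close> and the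
  \<open>(N - k)\<close>-th one of \<open>f\<^sub>3 / f\<^sub>1\<close> nonzero. So \<open>k\<close> is constant for \<open>p \<noteq> 0\<close>, and the product, a function of two
  variables, cannot vanish only at \<open>p = 0\<close>. At \<open>p = 0\<close> this contradicts the vanishing of all \<open>f\<^sub>i\<close>.
\<close>

subsection \<open>Hankel determinants and poles\<close>

text \<open>For \<open>0 < r\<close> and \<open>g\<close> holomorphic near the circle this is 2 pi i
  times the Laurent coefficient of \<open>g\<close> at \<open>z^(-m-1)\<close>.\<close>

definition moment :: "real \<Rightarrow> (complex \<Rightarrow> complex) \<Rightarrow> nat \<Rightarrow> complex" where
  "moment r g m = contour_integral (circlepath 0 r) (\<lambda>z. g z * z ^ m)"

text \<open>As in Kronecker's theorem on Hankel matrices: if \<open>g\<close> is meromorphic near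
  the closed disc with \<open>n\<close> poles inside, counted with multiplicity, and none on the
  circle, this is nonzero at \<open>k = n\<close> and zero for every \<open>k > n\<close>. At
  \<open>k = 0\<close> it is the empty determinant 1.\<close>

definition hankel_det :: "real \<Rightarrow> (complex \<Rightarrow> complex) \<Rightarrow> nat \<Rightarrow> complex" where
  "hankel_det r g k = Determinant.det (Matrix.mat k k (\<lambda>(i, j). moment r g (i + j)))"

lemma contour_integrable_circlepath:
  assumes "continuous_on (sphere 0 r) g" "0 \<le> r"
  shows "g contour_integrable_on circlepath 0 r"
  using assms by (intro contour_integrable_continuous_circlepath) simp

lemma poly_eq_sum_lessThan:
  fixes p :: "'a::comm_semiring_1 poly"
  assumes "degree p < k"
  shows "poly p z = (\<Sum>i<k. coeff p i * z ^ i)"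
proof -
  have "(\<Sum>i\<le>degree p. coeff p i * z ^ i) = (\<Sum>i<k. coeff p i * z ^ i)"
    by (rule sum.mono_neutral_left) (use assms in \<open>auto simp: coeff_eq_0 not_le\<close>)
  then show ?thesis by (simp add: poly_altdef)
qed

text \<open>In the monomial basis the Hankel matrix is the Gram matrix of the bilinear form that
  integrates \<open>g p q\<close> over the circle.\<close>

lemma contour_integral_poly_mult_eq_moments:
  assumes g: "continuous_on (sphere 0 r) g" "0 \<le> r"
    and "degree p < k" "degree q < k"
  shows "contour_integral (circlepath 0 r) (\<lambda>z. g z * poly p z * poly q z) =
    (\<Sum>i<k. coeff q i * (\<Sum>j<k. moment r g (i + j) * coeff p j))"
proof -
  have int: "(\<lambda>z. c * (d * (g z * z ^ m))) contour_integrable_on circlepath 0 r" for c d m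
    by (intro contour_integrable_circlepath continuous_intros g)
  have "(\<lambda>z. g z * poly p z * poly q z) =
      (\<lambda>z. \<Sum>i<k. \<Sum>j<k. coeff q i * (coeff p j * (g z * z ^ (i + j))))"
  proof
    fix z
    have "g z * poly p z * poly q z = g z * (poly q z * poly p z)" by (simp add: mult_ac)
    also have "\<dots> = (\<Sum>i<k. \<Sum>j<k. g z * ((coeff q i * z ^ i) * (coeff p j * z ^ j)))"
      unfolding poly_eq_sum_lessThan[OF assms(3)] poly_eq_sum_lessThan[OF assms(4)] sum_product
      by (simp add: sum_distrib_left)
    also have "\<dots> = (\<Sum>i<k. \<Sum>j<k. coeff q i * (coeff p j * (g z * z ^ (i + j))))"
      by (simp add: power_add mult_ac)
    finally show "g z * poly p z * poly q z = \<dots>" .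
  qed
  moreover have "contour_integral (circlepath 0 r)
        (\<lambda>z. \<Sum>i<k. \<Sum>j<k. coeff q i * (coeff p j * (g z * z ^ (i + j)))) =
      (\<Sum>i<k. \<Sum>j<k. contour_integral (circlepath 0 r)
        (\<lambda>z. coeff q i * (coeff p j * (g z * z ^ (i + j)))))"
    by (simp add: contour_integral_sum contour_integrable_sum int)
  moreover have "contour_integral (circlepath 0 r) (\<lambda>z. c * (d * (g z * z ^ m))) = 
     c * (moment r g m * d)" for c d m
    using int[of 1 d m] int[of 1 1 m]
    by (simp add: contour_integral_lmul moment_def)
  ultimately show ?thesis
    by (simp add: sum_distrib_left)
qed

text \<open>A kernel vector of the Gram matrix, read as a list of coefficients, is a polynomial
  orthogonal to all polynomials of degree below \<open>k\<close>.\<close>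

lemma hankel_det_eq_0_iff:
  assumes g: "continuous_on (sphere 0 r) g" "0 \<le> r"
  shows "hankel_det r g k = 0 \<longleftrightarrow>
    (\<exists>p. p \<noteq> 0 \<and> degree p < k \<and>
      (\<forall>q. degree q < k \<longrightarrow> contour_integral (circlepath 0 r) (\<lambda>z. g z * poly p z * poly q z) = 0))"
proof -
  let ?A = "Matrix.mat k k (\<lambda>(i, j). moment r g (i + j))"
  have row: "vec_index (?A *\<^sub>v v) i = (\<Sum>j<k. moment r g (i + j) * vec_index v j)"
    if "v \<in> carrier_vec k" "i < k" for v i
    using that by (auto simp: scalar_prod_def lessThan_atLeast0)
  have "hankel_det r g k = 0 \<longleftrightarrow>
      (\<exists>v. v \<in> carrier_vec k \<and> v \<noteq> 0\<^sub>v k \<and> ?A *\<^sub>v v = 0\<^sub>v k)"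
    unfolding hankel_det_def by (rule det_0_iff_vec_prod_zero) simp
  also have "\<dots> \<longleftrightarrow> (\<exists>p. p \<noteq> 0 \<and> degree p < k \<and>
      (\<forall>i<k. (\<Sum>j<k. moment r g (i + j) * coeff p j) = 0))"
  proof safe
    fix v assume v: "v \<in> carrier_vec k" "v \<noteq> 0\<^sub>v k" and Av: "?A *\<^sub>v v = 0\<^sub>v k"
    define p where "p = (\<Sum>j<k. monom (vec_index v j) j)"
    have cp: "coeff p j = (if j < k then vec_index v j else 0)" for j
      by (simp add: p_def coeff_sum)
    obtain j where j: "j < k" "vec_index v j \<noteq> 0"
      using v by (metis carrier_vecD eq_vecI index_zero_vec)
    then have "p \<noteq> 0" using cp by (metis coeff_0)
    \<comment> \<open>The nonzero entry \<open>j\<close> forces \<open>0 < k\<close>, so the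
      subtraction is not truncated.\<close>
    moreover have "degree p \<le> k - 1"
      by (rule degree_le) (use cp in auto)
    then have "degree p < k" using j by linarith
    moreover have "(\<Sum>j<k. moment r g (i + j) * coeff p j) = 0" if "i < k" for i
      using row[OF v(1) that] Av that cp by simp
    ultimately show "\<exists>p. p \<noteq> 0 \<and> degree p < k \<and>
        (\<forall>i<k. (\<Sum>j<k. moment r g (i + j) * coeff p j) = 0)" by blast
  next
    fix p assume p: "p \<noteq> 0" "degree p < k"
      and z: "\<forall>i<k. (\<Sum>j<k. moment r g (i + j) * coeff p j) = 0"
    let ?v = "Matrix.vec k (coeff p)"
    have "vec_index ?v (degree p) \<noteq> 0" using p by simp
    then have "?v \<noteq> 0\<^sub>v k" using p(2) by (metis index_zero_vec(1))
    moreover have "?A *\<^sub>v ?v = 0\<^sub>v k"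
    proof (rule eq_vecI)
      fix i assume "i < dim_vec (0\<^sub>v k :: complex Matrix.vec)"
      then have "i < k" by simp
      then show "vec_index (?A *\<^sub>v ?v) i = vec_index (0\<^sub>v k) i"
        using z row[of ?v i] by simp
    qed simp
    ultimately show "\<exists>v. v \<in> carrier_vec k \<and> v \<noteq> 0\<^sub>v k \<and> ?A *\<^sub>v v = 0\<^sub>v k"
      by (intro exI[of _ ?v]) simp
  qed
  also have "\<dots> \<longleftrightarrow> (\<exists>p. p \<noteq> 0 \<and> degree p < k \<and>
      (\<forall>q. degree q < k \<longrightarrow> contour_integral (circlepath 0 r) (\<lambda>z. g z * poly p z * poly q z) = 0))"
  proof -
    have "(\<forall>i<k. (\<Sum>j<k. moment r g (i + j) * coeff p j) = 0) \<longleftrightarrow>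
      (\<forall>q. degree q < k \<longrightarrow> contour_integral (circlepath 0 r) (\<lambda>z. g z * poly p z * poly q z) = 0)"
      if p: "degree p < k" for p
    proof safe
      fix q :: "complex poly" assume "\<forall>i<k. (\<Sum>j<k. moment r g (i + j) * coeff p j) = 0" "degree q < k"
      then show "contour_integral (circlepath 0 r) (\<lambda>z. g z * poly p z * poly q z) = 0"
        by (simp add: contour_integral_poly_mult_eq_moments[OF g p])
    next
      fix i assume *: "\<forall>q. degree q < k \<longrightarrow> contour_integral (circlepath 0 r) (\<lambda>z. g z * poly p z * poly q z) = 0"
        and i: "i < k"
      \<comment> \<open>Testing against the single monomial \<open>z^i\<close> recovers row
        \<open>i\<close> of the linear system.\<close>
      have d: "degree (monom 1 i :: complex poly) < k" using i by (simp add: degree_monom_eq)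
      have "(\<Sum>l<k. coeff (monom 1 i) l * (\<Sum>j<k. moment r g (l + j) * coeff p j)) = 0"
        using * d contour_integral_poly_mult_eq_moments[OF g p d] by metis
      then show "(\<Sum>j<k. moment r g (i + j) * coeff p j) = 0"
        using i by (simp add: coeff_monom if_distrib[of "\<lambda>x. x * _"] sum.delta cong: if_cong)
    qed
    then show ?thesis by (intro iff_exI conj_cong refl)
  qed
  finally show ?thesis .
qed

lemma contour_integral_circlepath_analytic:
  assumes "f analytic_on cball 0 r" "0 < r"
  shows "contour_integral (circlepath 0 r) f = 0"
proof (rule contour_integral_unique, rule Cauchy_theorem_convex_simple)
  show "f holomorphic_on cball 0 r" by (rule analytic_imp_holomorphic[OF assms(1)])
qed (use assms in auto)

lemma analytic_on_poly [analytic_intros]: "(\<lambda>z. poly p z) analytic_on S" for p :: "complex poly"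
proof -
  have "(\<lambda>z. poly p z) holomorphic_on UNIV"
    unfolding holomorphic_on_def field_differentiable_def
    using poly_DERIV has_field_derivative_at_within by blast
  then show ?thesis
    by (meson analytic_on_subset analytic_on_open open_UNIV subset_UNIV)
qed

text \<open>\<open>p\<close> clears the poles of \<open>g\<close>, so it lies in the kernel of the form \<open>(p, q) \<mapsto> \<ointegral> g p q\<close>.\<close>

lemma hankel_det_eq_0:
  assumes "continuous_on (sphere 0 r) g" "0 < r" "p \<noteq> 0" "degree p < k"
    and "w analytic_on cball 0 r" "\<And>z. z \<in> sphere 0 r \<Longrightarrow> g z * poly p z = w z"
  shows "hankel_det r g k = 0"
proof -
  have "contour_integral (circlepath 0 r) (\<lambda>z. g z * poly p z * poly q z) = 0" for q
  proof -
    have "contour_integral (circlepath 0 r) (\<lambda>z. g z * poly p z * poly q z) =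
        contour_integral (circlepath 0 r) (\<lambda>z. w z * poly q z)"
      by (rule contour_integral_eq) (use assms in simp)
    also have "\<dots> = 0"
      using assms by (intro contour_integral_circlepath_analytic analytic_intros)
    finally show ?thesis .
  qed
  then show ?thesis
    using assms by (subst hankel_det_eq_0_iff) auto
qed

text \<open>A kernel polynomial \<open>p\<close> has too small a degree to clear all poles of
  \<open>g\<close>. A suitable test polynomial reduces \<open>g p\<close> to a single simple pole,
  and Cauchy's formula shows that the integral is nonzero.\<close>

lemma hankel_det_neq_0:
  assumes r: "0 < r" and a: "a \<noteq> 0" "\<And>z. poly a z = 0 \<Longrightarrow> z \<in> ball 0 r"
    and b: "b analytic_on cball 0 r" "\<And>z. poly a z = 0 \<Longrightarrow> b z \<noteq> 0"
    and g: "\<And>z. z \<in> sphere 0 r \<Longrightarrow> g z * poly a z = b z"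
  shows "hankel_det r g (degree a) \<noteq> 0"
proof
  assume H: "hankel_det r g (degree a) = 0"
  have anz: "poly a z \<noteq> 0" if "z \<in> sphere 0 r" for z using a(2) that by fastforce
  have geq: "g z = b z / poly a z" if "z \<in> sphere 0 r" for z
    using g[OF that] anz[OF that] by (simp add: field_simps)
  have "continuous_on (sphere 0 r) b"
    using b(1) by (meson analytic_imp_holomorphic continuous_on_subset holomorphic_on_imp_continuous_on sphere_cball)
  then have "continuous_on (sphere 0 r) (\<lambda>z. b z / poly a z)"
    using anz by (intro continuous_intros) auto
  then have "continuous_on (sphere 0 r) g"
    using geq by (metis (no_types, lifting) continuous_on_cong)
  then obtain p where p: "p \<noteq> 0" "degree p < degree a"
    and pq: "\<And>q. degree q < degree a \<Longrightarrow>
      contour_integral (circlepath 0 r) (\<lambda>z. g z * poly p z * poly q z) = 0"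
    using H r by (subst (asm) hankel_det_eq_0_iff) auto
  \<comment> \<open>On the circle \<open>g p = b p' / a'\<close>, and \<open>a'\<close> still has a
    root because \<open>p\<close> has smaller degree than \<open>a\<close>.\<close>
  define d where "d = gcd a p"
  obtain a' p' where a': "a = d * a'" and p': "p = d * p'" and cop: "coprime a' p'"
    unfolding d_def using gcd_coprime_exists[of a p] a(1) by (metis gcd_eq_0_iff mult.commute)
  have nz: "d \<noteq> 0" "a' \<noteq> 0" "p' \<noteq> 0" using a' p' a(1) p(1) by auto
  have "degree a' \<noteq> 0"
    using p(2) nz by (auto simp: a' p' degree_mult_eq)
  then obtain \<zeta> where \<zeta>: "poly a' \<zeta> = 0"
    using alg_closed_imp_poly_has_root[of a'] by blast
  \<comment> \<open>The test polynomial \<open>q = a' / (z - \<zeta>)\<close> reduces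
    \<open>g p q\<close> to \<open>b p' / (z - \<zeta>)\<close>.\<close>
  then obtain q where q: "a' = [:-\<zeta>, 1:] * q" by (auto simp: poly_eq_0_iff_dvd elim: dvdE)
  have "q \<noteq> 0" using q nz by auto
  then have "degree q < degree a"
    using nz by (simp add: a' q degree_mult_eq del: mult_pCons_left)
  have "poly a \<zeta> = 0" using \<zeta> by (simp add: a')
  then have \<zeta>r: "\<zeta> \<in> ball 0 r" and b\<zeta>: "b \<zeta> \<noteq> 0" using a b by auto
  have p'\<zeta>: "poly p' \<zeta> \<noteq> 0"
    using cop \<zeta> by (metis coprime_poly_0)
  have "g z * poly p z * poly q z = b z * poly p' z / (z - \<zeta>)" if z: "z \<in> sphere 0 r" for z
  proof -
    have "poly a z = poly d z * ((z - \<zeta>) * poly q z)" by (simp add: a' q algebra_simps)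
    then show ?thesis using anz[OF z] geq[OF z] by (simp add: p')
  qed
  then have "contour_integral (circlepath 0 r) (\<lambda>z. b z * poly p' z / (z - \<zeta>)) =
      contour_integral (circlepath 0 r) (\<lambda>z. g z * poly p z * poly q z)"
    using r by (intro contour_integral_eq) simp
  also have "\<dots> = 0" by (rule pq) fact
  finally have "contour_integral (circlepath 0 r) (\<lambda>z. b z * poly p' z / (z - \<zeta>)) = 0" .
  moreover have "((\<lambda>z. b z * poly p' z / (z - \<zeta>)) has_contour_integral
      2 * of_real pi * \<i> * (b \<zeta> * poly p' \<zeta>)) (circlepath 0 r)"
  proof (rule Cauchy_integral_circlepath)
    have h: "(\<lambda>z. b z * poly p' z) holomorphic_on cball 0 r"
      by (intro analytic_imp_holomorphic analytic_intros b)
    then show "continuous_on (cball 0 r) (\<lambda>z. b z * poly p' z)"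
      by (rule holomorphic_on_imp_continuous_on)
    show "(\<lambda>z. b z * poly p' z) holomorphic_on ball 0 r"
      by (rule holomorphic_on_subset[OF h]) auto
  qed (use \<zeta>r in simp)
  ultimately show False
    using b\<zeta> p'\<zeta> contour_integral_unique by fastforce
qed

subsection \<open>Polynomial divisors of analytic functions\<close>

text \<open>The singularity of the quotient at \<open>\<zeta>\<close> is removable, with the
  derivative as value. The factorisation is a pointwise identity, so it holds off \<open>S\<close>
  as well.\<close>

lemma analytic_factor_root:
  assumes "f analytic_on S" "f \<zeta> = 0"
  shows "\<exists>g. g analytic_on S \<and> (\<forall>z. f z = (z - \<zeta>) * g z)"
proof (intro exI conjI allI)
  let ?g = "\<lambda>z. if z = \<zeta> then deriv f \<zeta> else f z / (z - \<zeta>)"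
  show "?g analytic_on S"
    by (rule pole_theorem_analytic_0[OF assms(1), where a = \<zeta>])
       (use assms(2) in \<open>auto intro: exI[of _ 1]\<close>)
  show "f z = (z - \<zeta>) * ?g z" for z using assms(2) by simp
qed

text \<open>The open disc without a finite set is dense in the closed disc, so continuity extends
  the equality.\<close>

lemma eq_on_cball_if_eq_off_finite:
  fixes f g :: "complex \<Rightarrow> complex"
  assumes "0 < r" "continuous_on (cball 0 r) f" "continuous_on (cball 0 r) g" "finite Z"
    and eq: "\<And>z. z \<in> cball 0 r \<Longrightarrow> z \<notin> Z \<Longrightarrow> f z = g z" and z: "z \<in> cball 0 r"
  shows "f z = g z"
proof -
  have "x \<in> closure (ball 0 r - Z)" if "x \<in> ball 0 r" for x :: complex
  proof -
    have "x islimpt ball 0 r" using that by (simp add: interior_limit_point)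
    moreover have "ball 0 r \<subseteq> Z \<union> (ball 0 r - Z)" by auto
    ultimately have "x islimpt Z \<union> (ball 0 r - Z)" by (rule islimpt_subset)
    then have "x islimpt ball 0 r - Z" using islimpt_Un_finite[OF \<open>finite Z\<close>] by blast
    then show ?thesis by (simp add: closure_def)
  qed
  then have "ball 0 r \<subseteq> closure (ball (0::complex) r - Z)" by blast
  then have "closure (ball 0 r) \<subseteq> closure (ball (0::complex) r - Z)"
    by (simp add: closure_minimal)
  moreover have "closure (ball (0::complex) r - Z) \<subseteq> closure (ball 0 r)"
    by (intro closure_mono) auto
  ultimately have cl: "closure (ball (0::complex) r - Z) = cball 0 r" using \<open>0 < r\<close> by simp
  have "f z - g z = 0"
  proof (rule continuous_constant_on_closure[of "ball 0 r - Z" "\<lambda>z. f z - g z"])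
    show "continuous_on (closure (ball 0 r - Z)) (\<lambda>z. f z - g z)"
      unfolding cl by (intro continuous_intros assms)
  qed (use eq z cl in auto)
  then show ?thesis by simp
qed

lemma analytic_imp_continuous_on: "f analytic_on S \<Longrightarrow> continuous_on S f"
  by (simp add: analytic_imp_holomorphic holomorphic_on_imp_continuous_on)

lemma poly_mult_cancel_on_cball:
  assumes "0 < r" "f analytic_on cball 0 r" "g analytic_on cball 0 r" "d \<noteq> 0"
    and "\<And>z. z \<in> cball 0 r \<Longrightarrow> poly d z * f z = poly d z * g z" "z \<in> cball 0 r"
  shows "f z = g z"
proof (rule eq_on_cball_if_eq_off_finite[where f = f and g = g and Z = "{z. poly d z = 0}"])
  show "finite {z. poly d z = 0}" using \<open>d \<noteq> 0\<close> by (rule poly_roots_finite)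
qed (use assms in \<open>auto intro: analytic_imp_continuous_on\<close>)

text \<open>Euclid's lemma for coprime \<open>a\<close> and \<open>b\<close>: each root of
  \<open>a\<close> must be a zero of \<open>f\<close>, and cancelling it on both sides lowers the
  degree of \<open>a\<close>.\<close>

lemma poly_dvd_analytic_of_nonzero:
  assumes "0 < r" "a \<noteq> 0" "\<And>z. poly a z = 0 \<Longrightarrow> z \<in> cball 0 r" "\<And>z. poly a z = 0 \<Longrightarrow> b z \<noteq> 0"
    and "b analytic_on cball 0 r" "f analytic_on cball 0 r" "w analytic_on cball 0 r"
    and "\<And>z. z \<in> cball 0 r \<Longrightarrow> b z * f z = poly a z * w z"
  shows "\<exists>e. e analytic_on cball 0 r \<and> (\<forall>z\<in>cball 0 r. f z = poly a z * e z)"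
  using assms(2-4,6,8)
proof (induction "degree a" arbitrary: a f rule: less_induct)
  case (less a f)
  show ?case
  proof (cases "degree a = 0")
    case True
    then obtain c where c: "a = [:c:]" by (rule degree_eq_zeroE)
    then have "c \<noteq> 0" using less.prems(1) by auto
    then show ?thesis
      by (intro exI[of _ "\<lambda>z. f z / c"]) (auto simp: c intro!: analytic_intros less.prems)
  next
    case False
    then obtain \<zeta> where \<zeta>: "poly a \<zeta> = 0" using alg_closed_imp_poly_has_root[of a] by blast
    then obtain a' where a': "a = [:-\<zeta>, 1:] * a'" by (auto simp: poly_eq_0_iff_dvd elim: dvdE)
    have "a' \<noteq> 0" using a' less.prems(1) by auto
    then have deg: "degree a' < degree a"
      by (simp add: a' degree_mult_eq del: mult_pCons_left)
    have "b \<zeta> * f \<zeta> = 0" using less.prems(5)[of \<zeta>] less.prems(2)[OF \<zeta>] \<zeta> by simp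
    then have "f \<zeta> = 0" using less.prems(3)[OF \<zeta>] by simp
    then obtain f' where f': "f' analytic_on cball 0 r" "\<And>z. f z = (z - \<zeta>) * f' z"
      using analytic_factor_root[OF less.prems(4)] by blast
    have "b z * f' z = poly a' z * w z" if "z \<in> cball 0 r" for z
    proof (rule poly_mult_cancel_on_cball[where d = "[:-\<zeta>, 1:]", OF \<open>0 < r\<close> _ _ _ _ that])
      fix z :: complex assume "z \<in> cball 0 r"
      then show "poly [:-\<zeta>, 1:] z * (b z * f' z) = poly [:-\<zeta>, 1:] z * (poly a' z * w z)"
        using less.prems(5)[of z] by (simp add: a' f'(2) algebra_simps)
    qed (auto intro!: analytic_intros assms f')
    moreover have "z \<in> cball 0 r" "b z \<noteq> 0" if "poly a' z = 0" for z
      using less.prems(2,3)[of z] that by (simp_all add: a')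
    ultimately obtain e where e: "e analytic_on cball 0 r"
      "\<And>z. z \<in> cball 0 r \<Longrightarrow> f' z = poly a' z * e z"
      using less.hyps[OF deg \<open>a' \<noteq> 0\<close> _ _ f'(1)] by blast
    then show ?thesis
      by (intro exI[of _ e]) (auto simp: f'(2) a' algebra_simps)
  qed
qed

text \<open>
  A pointwise substitute for unique factorisation: \<open>d\<close> is a divisor of \<open>Q\<close> of maximal degree that
  still divides \<open>f2\<close>, so \<open>a = Q / d\<close> has to divide \<open>f3\<close>.
\<close>

lemma split_poly_divisor:
  assumes "0 < r" "Q \<noteq> 0" "\<And>z. poly Q z = 0 \<Longrightarrow> z \<in> cball 0 r"
    and f: "f2 analytic_on cball 0 r" "f3 analytic_on cball 0 r" "w analytic_on cball 0 r"
    and eq: "\<And>z. z \<in> cball 0 r \<Longrightarrow> f2 z * f3 z = poly Q z * w z"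
    and nz: "\<And>z. poly Q z = 0 \<Longrightarrow> f2 z \<noteq> 0 \<or> f3 z \<noteq> 0 \<or> w z \<noteq> 0"
  shows "\<exists>a d b e. Q = a * d \<and> b analytic_on cball 0 r \<and> e analytic_on cball 0 r \<and>
    (\<forall>z\<in>cball 0 r. f2 z = poly d z * b z \<and> f3 z = poly a z * e z) \<and>
    (\<forall>z. poly a z = 0 \<longrightarrow> b z \<noteq> 0) \<and> (\<forall>z. poly d z = 0 \<longrightarrow> e z \<noteq> 0)"
proof -
  define P where "P d \<longleftrightarrow> d dvd Q \<and>
    (\<exists>b. b analytic_on cball 0 r \<and> (\<forall>z\<in>cball 0 r. f2 z = poly d z * b z))" for d
  have "P 1" unfolding P_def using f(1) by auto
  moreover have "\<forall>d. P d \<longrightarrow> degree d < Suc (degree Q)"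
    unfolding P_def using \<open>Q \<noteq> 0\<close> dvd_imp_degree_le by (metis le_imp_less_Suc)
  ultimately obtain d where d: "P d" and max: "\<And>d'. P d' \<Longrightarrow> degree d' \<le> degree d"
    using ex_has_greatest_nat[of P 1 degree "Suc (degree Q)"] by blast
  obtain a b where a: "Q = a * d" and b: "b analytic_on cball 0 r"
    and f2: "\<And>z. z \<in> cball 0 r \<Longrightarrow> f2 z = poly d z * b z"
    using d unfolding P_def by (metis dvdE mult.commute)
  have ad: "a \<noteq> 0" "d \<noteq> 0" using a \<open>Q \<noteq> 0\<close> by auto
  \<comment> \<open>A common root of \<open>a\<close> and \<open>b\<close> could be moved into
    \<open>d\<close>, against maximality.\<close>
  have bnz: "b z \<noteq> 0" if az: "poly a z = 0" for z
  proof
    assume "b z = 0"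
    then obtain b' where b': "b' analytic_on cball 0 r" "\<And>x. b x = (x - z) * b' x"
      using analytic_factor_root[OF b] by blast
    obtain a' where a': "a = [:-z, 1:] * a'"
      using az by (auto simp: poly_eq_0_iff_dvd elim: dvdE)
    have "P ([:-z, 1:] * d)"
      unfolding P_def
    proof (intro conjI exI[of _ b'] ballI b')
      show "[:-z, 1:] * d dvd Q" unfolding a a' by (metis dvd_triv_left mult.assoc mult.commute)
      fix x :: complex assume "x \<in> cball 0 r"
      then show "f2 x = poly ([:-z, 1:] * d) x * b' x" using f2 by (simp add: b'(2) algebra_simps)
    qed
    from max[OF this] show False using ad by (simp add: degree_mult_eq del: mult_pCons_left)
  qed
  have bf3: "b z * f3 z = poly a z * w z" if "z \<in> cball 0 r" for z
  proof (rule poly_mult_cancel_on_cball[where d = d, OF \<open>0 < r\<close> _ _ _ _ that])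
    fix z :: complex assume "z \<in> cball 0 r"
    then show "poly d z * (b z * f3 z) = poly d z * (poly a z * w z)"
      using eq[of z] f2[of z] by (simp add: a algebra_simps)
  qed (auto intro!: analytic_intros f b ad)
  moreover have "z \<in> cball 0 r" if "poly a z = 0" for z using assms(3)[of z] that by (simp add: a)
  ultimately obtain e where e: "e analytic_on cball 0 r"
    and f3: "\<And>z. z \<in> cball 0 r \<Longrightarrow> f3 z = poly a z * e z"
    using poly_dvd_analytic_of_nonzero[OF \<open>0 < r\<close> ad(1) _ bnz b f(2,3)] by blast
  have bew: "b z * e z = w z" if "z \<in> cball 0 r" for z
  proof (rule poly_mult_cancel_on_cball[where d = a, OF \<open>0 < r\<close> _ _ _ _ that])
    fix z :: complex assume "z \<in> cball 0 r"
    then show "poly a z * (b z * e z) = poly a z * w z"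
      using bf3[of z] f3[of z] by (simp add: algebra_simps)
  qed (auto intro!: analytic_intros f b e ad)
  \<comment> \<open>At a root of \<open>d\<close> the function \<open>f2\<close> vanishes. If
    \<open>e\<close> vanished too, then so would \<open>f3 = a e\<close> and
    \<open>w = b e\<close>.\<close>
  have "e z \<noteq> 0" if "poly d z = 0" for z
  proof
    assume "e z = 0"
    have "poly Q z = 0" using that by (simp add: a)
    moreover from this have "z \<in> cball 0 r" by (rule assms(3))
    ultimately show False using nz[of z] f2[of z] f3[of z] bew[of z] \<open>e z = 0\<close> that by simp
  qed
  then show ?thesis using a b e f2 f3 bnz by blast
qed

section \<open>Splitting off the zeros of a holomorphic function in a disc\<close>

lemma holomorphic_factor_power:
  assumes f: "f holomorphic_on ball 0 R" and \<zeta>: "\<zeta> \<in> ball 0 R" and z0: "z0 \<in> ball 0 R" "f z0 \<noteq> 0"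
  obtains n g where "g holomorphic_on ball 0 R" "g \<zeta> \<noteq> 0" "\<And>z. f z = (z - \<zeta>) ^ n * g z"
proof (cases "f \<zeta> = 0")
  case False
  then show thesis using that[of f 0] f by simp
next
  case True
  \<comment> \<open>The nonzero value at \<open>z0\<close> excludes the zero function, so the order
    of vanishing at \<open>\<zeta>\<close> is finite.\<close>
  then have "\<not> f constant_on ball 0 R" using \<zeta> z0 by (metis constant_on_def)
  then obtain g \<rho> n where n: "0 < n" "0 < \<rho>" "ball \<zeta> \<rho> \<subseteq> ball 0 R"
    and g: "g holomorphic_on ball \<zeta> \<rho>" "\<And>w. w \<in> ball \<zeta> \<rho> \<Longrightarrow> f w = (w - \<zeta>) ^ n * g w"
    "\<And>w. w \<in> ball \<zeta> \<rho> \<Longrightarrow> g w \<noteq> 0"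
    using holomorphic_factor_zero_nonconstant[OF f open_ball connected_ball \<zeta> True]
    by (metis (no_types, lifting))
  \<comment> \<open>The local cofactor near \<open>\<zeta>\<close> and the quotient away from
    \<open>\<zeta>\<close> agree on the overlap and glue to one function.\<close>
  define h where "h z = (if z = \<zeta> then g \<zeta> else f z / (z - \<zeta>) ^ n)" for z
  have "h holomorphic_on ball \<zeta> \<rho> \<union> (ball 0 R - {\<zeta>})"
  proof (rule holomorphic_on_Un)
    show "h holomorphic_on ball \<zeta> \<rho>"
      by (rule holomorphic_transform[OF g(1)]) (auto simp: h_def g(2))
    have "(\<lambda>z. f z / (z - \<zeta>) ^ n) holomorphic_on ball 0 R - {\<zeta>}"
      by (intro holomorphic_intros holomorphic_on_subset[OF f]) auto
    then show "h holomorphic_on ball 0 R - {\<zeta>}"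
      by (rule holomorphic_transform) (auto simp: h_def)
  qed (auto simp: open_delete)
  moreover have "ball \<zeta> \<rho> \<union> (ball 0 R - {\<zeta>}) = ball 0 R" using n(2,3) by auto
  ultimately have "h holomorphic_on ball 0 R" by simp
  moreover have "h \<zeta> \<noteq> 0" using g(3) n(2) by (simp add: h_def)
  moreover have "f z = (z - \<zeta>) ^ n * h z" for z using True n(1) by (simp add: h_def)
  ultimately show thesis by (rule that)
qed

text \<open>By compactness there are finitely many zeros in the closed disc, none of them on the
  circle. Splitting them off one after another leaves a zero-free cofactor there.\<close>

lemma holomorphic_eq_poly_mult_nonzero:
  assumes f: "f holomorphic_on ball 0 R" and r: "0 < r" "r < R"
    and nz: "\<And>z. z \<in> sphere 0 r \<Longrightarrow> f z \<noteq> 0"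
  obtains Q u where "Q \<noteq> 0" "\<And>z. poly Q z = 0 \<Longrightarrow> z \<in> ball 0 r" "u holomorphic_on ball 0 R"
    "\<And>z. z \<in> cball 0 r \<Longrightarrow> u z \<noteq> 0" "\<And>z. f z = poly Q z * u z"
proof -
  have sub: "cball 0 r \<subseteq> ball (0::complex) R" using r by auto
  have rs: "of_real r \<in> sphere (0::complex) r" "of_real r \<in> ball (0::complex) R" using r by auto
  \<comment> \<open>Stated for an arbitrary finite set \<open>Z\<close> of points, zeros or not, to
    allow induction on \<open>Z\<close>; a point that is not a zero gets exponent 0.\<close>
  have main: "\<exists>Q u. Q \<noteq> 0 \<and> (\<forall>z. poly Q z = 0 \<longrightarrow> z \<in> Z) \<and> u holomorphic_on ball 0 R \<and>
      (\<forall>z\<in>Z. u z \<noteq> 0) \<and> (\<forall>z. f z = poly Q z * u z)"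
    if "finite Z" "Z \<subseteq> ball 0 r" for Z
    using that
  proof (induction Z rule: finite_induct)
    case empty
    show ?case by (rule exI[of _ 1], rule exI[of _ f]) (use f in auto)
  next
    case (insert \<zeta> Z)
    then obtain Q u where Q: "Q \<noteq> 0" "\<And>z. poly Q z = 0 \<Longrightarrow> z \<in> Z" and u: "u holomorphic_on ball 0 R"
      "\<And>z. z \<in> Z \<Longrightarrow> u z \<noteq> 0" "\<And>z. f z = poly Q z * u z" by auto
    have "u (of_real r) \<noteq> 0" using nz[OF rs(1)] u(3)[of "of_real r"] by auto
    moreover have "\<zeta> \<in> ball 0 R" using insert.prems r by auto
    ultimately obtain n g where g: "g holomorphic_on ball 0 R" "g \<zeta> \<noteq> 0" "\<And>z. u z = (z - \<zeta>) ^ n * g z"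
      using holomorphic_factor_power[OF u(1) _ rs(2)] by blast
    show ?case
    proof (rule exI[of _ "Q * [:-\<zeta>, 1:] ^ n"], rule exI[of _ g], intro conjI allI ballI impI)
      show "Q * [:-\<zeta>, 1:] ^ n \<noteq> 0" using Q(1) by simp
      show "z \<in> insert \<zeta> Z" if "poly (Q * [:-\<zeta>, 1:] ^ n) z = 0" for z
        using that Q(2)[of z] by (auto simp: poly_power)
      show "g z \<noteq> 0" if "z \<in> insert \<zeta> Z" for z using that g(2) g(3)[of z] u(2)[of z] by auto
      show "f z = poly (Q * [:-\<zeta>, 1:] ^ n) z * g z" for z
        using u(3)[of z] g(3)[of z] by (simp add: poly_power)
    qed (rule g)
  qed
  have fin: "finite {z \<in> cball 0 r. f z = 0}"
  proof (cases "f constant_on ball 0 R")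
    case True
    then have "{z \<in> cball 0 r. f z = 0} = {}"
      using nz[OF rs(1)] rs(2) sub unfolding constant_on_def by (metis (mono_tags, lifting) empty_Collect_eq subsetD)
    then show ?thesis by (metis finite.emptyI)
  qed (use holomorphic_compact_finite_zeros[OF f open_ball connected_ball compact_cball sub] in blast)
  have "{z \<in> cball 0 r. f z = 0} \<subseteq> ball 0 r"
    using nz by (force simp: less_le)
  from main[OF fin this] obtain Q u where Q: "Q \<noteq> 0"
    "\<And>z. poly Q z = 0 \<Longrightarrow> z \<in> {z \<in> cball 0 r. f z = 0}" and u: "u holomorphic_on ball 0 R"
    "\<And>z. z \<in> {z \<in> cball 0 r. f z = 0} \<Longrightarrow> u z \<noteq> 0" "\<And>z. f z = poly Q z * u z" by blast
  show thesis
  proof (rule that[OF Q(1) _ u(1) _ u(3)])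
    show "z \<in> ball 0 r" if "poly Q z = 0" for z
      using Q(2)[OF that] \<open>{z \<in> cball 0 r. f z = 0} \<subseteq> ball 0 r\<close> by blast
    show "u z \<noteq> 0" if "z \<in> cball 0 r" for z
      using u(2)[of z] u(3)[of z] that by auto
  qed
qed

subsection \<open>Counting zeros by the logarithmic derivative\<close>

text \<open>By the argument principle, 2 pi i times the number of zeros inside the circle, if
  \<open>f\<close> is holomorphic near the closed disc without zeros on the circle.\<close>

definition log_integral :: "real \<Rightarrow> (complex \<Rightarrow> complex) \<Rightarrow> complex" where
  "log_integral r f = contour_integral (circlepath 0 r) (\<lambda>z. deriv f z / f z)"

lemma log_deriv_integrable:
  assumes "f analytic_on sphere 0 r" "\<And>z. z \<in> sphere 0 r \<Longrightarrow> f z \<noteq> 0" "0 < r"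
  shows "(\<lambda>z. deriv f z / f z) contour_integrable_on circlepath 0 r"
  using assms
  by (intro contour_integrable_circlepath analytic_imp_continuous_on analytic_intros) auto

lemma log_integral_mult:
  assumes f: "f analytic_on sphere 0 r" "\<And>z. z \<in> sphere 0 r \<Longrightarrow> f z \<noteq> 0"
    and g: "g analytic_on sphere 0 r" "\<And>z. z \<in> sphere 0 r \<Longrightarrow> g z \<noteq> 0" and "0 < r"
  shows "log_integral r (\<lambda>z. f z * g z) = log_integral r f + log_integral r g"
proof -
  have quot: "(a * b' + a' * b) / (a * b) = a' / a + b' / b" if "a \<noteq> 0" "b \<noteq> 0" for a b a' b' :: complex
    using that by (simp add: add_divide_distrib)
  have "log_integral r (\<lambda>z. f z * g z) =
      contour_integral (circlepath 0 r) (\<lambda>z. deriv f z / f z + deriv g z / g z)"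
    unfolding log_integral_def
  proof (rule contour_integral_eq)
    fix z assume "z \<in> path_image (circlepath 0 r)"
    then have z: "z \<in> sphere 0 r" using \<open>0 < r\<close> by simp
    have "deriv (\<lambda>z. f z * g z) z = f z * deriv g z + deriv f z * g z"
      by (intro deriv_mult analytic_on_imp_differentiable_at[OF _ z] f g)
    then show "deriv (\<lambda>z. f z * g z) z / (f z * g z) = deriv f z / f z + deriv g z / g z"
      using f(2)[OF z] g(2)[OF z] quot[of "f z" "g z"] by simp
  qed
  also have "\<dots> = log_integral r f + log_integral r g"
    unfolding log_integral_def
    by (intro contour_integral_add log_deriv_integrable assms)
  finally show ?thesis .
qed

lemma log_integral_divide:
  assumes f: "f analytic_on sphere 0 r" "\<And>z. z \<in> sphere 0 r \<Longrightarrow> f z \<noteq> 0"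
    and g: "g analytic_on sphere 0 r" "\<And>z. z \<in> sphere 0 r \<Longrightarrow> g z \<noteq> 0" and "0 < r"
  shows "log_integral r (\<lambda>z. f z / g z) = log_integral r f - log_integral r g"
proof -
  have quot: "(a' * b - a * b') / b\<^sup>2 / (a / b) = a' / a - b' / b"
    if "a \<noteq> 0" "b \<noteq> 0" for a b a' b' :: complex
    using that by (simp add: power2_eq_square frac_eq_eq diff_frac_eq)
  have "log_integral r (\<lambda>z. f z / g z) =
      contour_integral (circlepath 0 r) (\<lambda>z. deriv f z / f z - deriv g z / g z)"
    unfolding log_integral_def
  proof (rule contour_integral_eq)
    fix z assume "z \<in> path_image (circlepath 0 r)"
    then have z: "z \<in> sphere 0 r" using \<open>0 < r\<close> by simp
    have "deriv (\<lambda>z. f z / g z) z = (deriv f z * g z - f z * deriv g z) / (g z)\<^sup>2"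
      by (intro deriv_divide analytic_on_imp_differentiable_at[OF _ z] f g z)
    then show "deriv (\<lambda>z. f z / g z) z / (f z / g z) = deriv f z / f z - deriv g z / g z"
      using f(2)[OF z] g(2)[OF z] quot[of "f z" "g z"] by simp
  qed
  also have "\<dots> = log_integral r f - log_integral r g"
    unfolding log_integral_def
    by (intro contour_integral_diff log_deriv_integrable assms)
  finally show ?thesis .
qed

lemma log_integral_nonvanishing:
  assumes "u analytic_on cball 0 r" "\<And>z. z \<in> cball 0 r \<Longrightarrow> u z \<noteq> 0" "0 < r"
  shows "log_integral r u = 0"
  unfolding log_integral_def using assms
  by (intro contour_integral_circlepath_analytic analytic_intros)

text \<open>The values of \<open>h\<close> on the circle lie in the right half plane, so
  \<open>Ln\<close> composed with \<open>h\<close> is a primitive of the integrand along a closed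
  path.\<close>

lemma log_integral_near_1:
  assumes h: "h analytic_on sphere 0 r" "\<And>z. z \<in> sphere 0 r \<Longrightarrow> norm (h z - 1) < 1" and "0 < r"
  shows "log_integral r h = 0"
proof -
  have "((\<lambda>z. deriv h z / h z) has_contour_integral
      (Ln (h (pathfinish (circlepath 0 r))) - Ln (h (pathstart (circlepath 0 r))))) (circlepath 0 r)"
  proof (rule contour_integral_primitive[where S = "sphere 0 r"])
    fix z :: complex assume z: "z \<in> sphere 0 r"
    have "Re (h z) > 0"
      using abs_Re_le_cmod[of "h z - 1"] h(2)[OF z] by simp
    then have "h z \<notin> \<real>\<^sub>\<le>\<^sub>0" by (auto simp: complex_nonpos_Reals_iff)
    moreover have "(h has_field_derivative deriv h z) (at z)"
      by (simp add: DERIV_deriv_iff_field_differentiable analytic_on_imp_differentiable_at[OF h(1) z])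
    ultimately have "((\<lambda>z. Ln (h z)) has_field_derivative deriv h z / h z) (at z)"
      by (auto intro!: derivative_eq_intros simp: field_simps)
    then show "((\<lambda>z. Ln (h z)) has_field_derivative deriv h z / h z) (at z within sphere 0 r)"
      by (rule has_field_derivative_at_within)
  qed (use \<open>0 < r\<close> in auto)
  then show ?thesis unfolding log_integral_def by (simp add: contour_integral_unique)
qed

text \<open>Each linear factor contributes 2 pi i by Cauchy's formula.\<close>

lemma log_integral_poly:
  assumes "p \<noteq> 0" "\<And>z. poly p z = 0 \<Longrightarrow> z \<in> ball 0 r" "0 < r"
  shows "log_integral r (poly p) = 2 * of_real pi * \<i> * of_nat (degree p)"
  using assms(1,2)
proof (induction "degree p" arbitrary: p)
  case 0
  then obtain c where c: "p = [:c:]" by (metis degree_eq_zeroE)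
  then have "poly p = (\<lambda>z. c)" by auto
  then show ?case using 0 by (simp add: log_integral_def)
next
  case (Suc n)
  then obtain \<zeta> where \<zeta>: "poly p \<zeta> = 0" using alg_closed_imp_poly_has_root[of p] by auto
  then obtain q where q: "p = [:-\<zeta>, 1:] * q" by (auto simp: poly_eq_0_iff_dvd elim: dvdE)
  have "q \<noteq> 0" using q Suc.prems by auto
  then have "degree p = Suc (degree q)" by (simp add: q degree_mult_eq del: mult_pCons_left)
  have root: "z \<in> ball 0 r" if "poly q z = 0" for z using Suc.prems(2)[of z] that by (simp add: q)
  have \<zeta>r: "\<zeta> \<in> ball 0 r" by (rule Suc.prems(2)[OF \<zeta>])
  have "((\<lambda>z. 1 / (z - \<zeta>)) has_contour_integral 2 * of_real pi * \<i> * 1) (circlepath 0 r)"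
    by (rule Cauchy_integral_circlepath) (use \<zeta>r in auto)
  moreover have "deriv (\<lambda>z. z - \<zeta>) z = 1" for z
    by (rule DERIV_imp_deriv) (auto intro!: derivative_eq_intros)
  ultimately have "log_integral r (\<lambda>z. z - \<zeta>) = 2 * of_real pi * \<i>"
    unfolding log_integral_def by (simp add: contour_integral_unique)
  moreover have "log_integral r (poly q) = 2 * of_real pi * \<i> * of_nat (degree q)"
    by (rule Suc.hyps(1)) (use \<open>degree p = Suc (degree q)\<close> Suc.hyps(2) \<open>q \<noteq> 0\<close> root in auto)
  moreover have "log_integral r (\<lambda>z. (z - \<zeta>) * poly q z) =
      log_integral r (\<lambda>z. z - \<zeta>) + log_integral r (poly q)"
    by (rule log_integral_mult) (use \<open>0 < r\<close> \<zeta>r root in \<open>force intro!: analytic_intros\<close>)+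
  moreover have "poly p = (\<lambda>z. (z - \<zeta>) * poly q z)" by (auto simp: q algebra_simps)
  ultimately show ?case using \<open>degree p = Suc (degree q)\<close> by (simp add: algebra_simps)
qed

text \<open>Rouche's theorem: the quotient of the two functions stays within distance 1 of 1 on the
  circle, so their logarithmic integrals agree, and the zero-free factors contribute
  nothing.\<close>

lemma degree_eq_if_close_on_sphere:
  assumes "0 < r" and nz: "p \<noteq> 0" "q \<noteq> 0"
    and p: "\<And>z. poly p z = 0 \<Longrightarrow> z \<in> ball 0 r" and q: "\<And>z. poly q z = 0 \<Longrightarrow> z \<in> ball 0 r"
    and u: "u analytic_on cball 0 r" "\<And>z. z \<in> cball 0 r \<Longrightarrow> u z \<noteq> 0"
    and v: "v analytic_on cball 0 r" "\<And>z. z \<in> cball 0 r \<Longrightarrow> v z \<noteq> 0"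
    and close: "\<And>z. z \<in> sphere 0 r \<Longrightarrow>
      norm (poly p z * u z - poly q z * v z) < norm (poly q z * v z)"
  shows "degree p = degree q"
proof -
  have sph: "u analytic_on sphere 0 r" "v analytic_on sphere 0 r"
    using u(1) v(1) by (meson analytic_on_subset sphere_cball)+
  have pnz: "poly p z \<noteq> 0" and qnz: "poly q z \<noteq> 0" and unz: "u z \<noteq> 0" and vnz: "v z \<noteq> 0"
    if "z \<in> sphere 0 r" for z
    using that p[of z] q[of z] u(2)[of z] v(2)[of z] by auto
  have "0 = log_integral r (\<lambda>z. (poly p z * u z) / (poly q z * v z))"
  proof (rule log_integral_near_1[symmetric])
    show "(\<lambda>z. (poly p z * u z) / (poly q z * v z)) analytic_on sphere 0 r"
      using qnz vnz by (intro analytic_intros sph) auto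
    fix z :: complex assume z: "z \<in> sphere 0 r"
    have "(poly p z * u z) / (poly q z * v z) - 1 =
        (poly p z * u z - poly q z * v z) / (poly q z * v z)"
      using qnz[OF z] vnz[OF z] by (simp add: field_simps)
    then show "norm ((poly p z * u z) / (poly q z * v z) - 1) < 1"
      using close[OF z] qnz[OF z] vnz[OF z] by (simp add: norm_divide divide_less_eq)
  qed fact
  also have "\<dots> = log_integral r (\<lambda>z. poly p z * u z) - log_integral r (\<lambda>z. poly q z * v z)"
    using pnz qnz unz vnz \<open>0 < r\<close> by (intro log_integral_divide analytic_intros sph) auto
  also have "log_integral r (\<lambda>z. poly p z * u z) = log_integral r (poly p) + log_integral r u"
    using pnz unz \<open>0 < r\<close> by (intro log_integral_mult analytic_intros sph) auto
  also have "log_integral r (\<lambda>z. poly q z * v z) = log_integral r (poly q) + log_integral r v"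
    using qnz vnz \<open>0 < r\<close> by (intro log_integral_mult analytic_intros sph) auto
  also have "log_integral r u = 0" by (rule log_integral_nonvanishing[OF u \<open>0 < r\<close>])
  also have "log_integral r v = 0" by (rule log_integral_nonvanishing[OF v \<open>0 < r\<close>])
  finally show ?thesis
    using log_integral_poly[OF nz(1) p \<open>0 < r\<close>] log_integral_poly[OF nz(2) q \<open>0 < r\<close>] by simp
qed

subsection \<open>Hankel determinants depending on parameters\<close>

lemma continuous_on_contour_integral_circlepath:
  fixes G :: "'a::topological_space \<Rightarrow> complex \<Rightarrow> complex"
  assumes "continuous_on (U \<times> sphere 0 r) (\<lambda>(x, z). G x z)" "0 < r"
  shows "continuous_on U (\<lambda>x. contour_integral (circlepath 0 r) (G x))"
proof -
  have "continuous_on (U \<times> cbox 0 1) (\<lambda>(x, t). G x (circlepath 0 r t) * vector_derivative (circlepath 0 r) (at t))"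
  proof -
    have "continuous_on (U \<times> cbox 0 1) (\<lambda>y. (\<lambda>(x, z). G x z) (fst y, circlepath 0 r (snd y)))"
    proof (rule continuous_on_compose2[OF assms(1)])
      show "continuous_on (U \<times> cbox 0 1) (\<lambda>y. (fst y, circlepath 0 r (snd y)))"
        unfolding circlepath_def part_circlepath_def linepath_def by (intro continuous_intros)
      have "circlepath 0 r t \<in> sphere 0 r" if "t \<in> {0..1}" for t
        using that \<open>0 < r\<close> path_image_circlepath_nonneg[of r 0] unfolding path_image_def by fastforce
      then show "(\<lambda>y. (fst y, circlepath 0 r (snd y))) ` (U \<times> cbox 0 1) \<subseteq> U \<times> sphere 0 r" by auto
    qed
    then show ?thesis
      unfolding vector_derivative_circlepath
      by (auto simp: case_prod_beta intro!: continuous_intros)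
  qed
  from integral_continuous_on_param[OF this] show ?thesis
    unfolding contour_integral_integral by simp
qed

text \<open>Morera's theorem: the integral along a triangle is exchanged with the one over the
  circle, and for each fixed \<open>z\<close> the inner integral vanishes by Cauchy.\<close>

lemma holomorphic_on_contour_integral_circlepath:
  fixes G :: "complex \<Rightarrow> complex \<Rightarrow> complex"
  assumes "open U" "0 < r" and cont: "continuous_on (U \<times> sphere 0 r) (\<lambda>(w, z). G w z)"
    and hol: "\<And>z. z \<in> sphere 0 r \<Longrightarrow> (\<lambda>w. G w z) holomorphic_on U"
  shows "(\<lambda>w. contour_integral (circlepath 0 r) (G w)) holomorphic_on U"
proof (rule analytic_imp_holomorphic, rule Morera_triangle)
  let ?I = "\<lambda>w. contour_integral (circlepath 0 r) (G w)"
  show "continuous_on U ?I"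
    by (rule continuous_on_contour_integral_circlepath[OF cont \<open>0 < r\<close>])
  show "open U" by fact
  fix a b c :: complex
  show "convex hull {a, b, c} \<subseteq> U \<longrightarrow> contour_integral (linepath a b) ?I +
    contour_integral (linepath b c) ?I + contour_integral (linepath c a) ?I = 0"
  proof
    assume sub: "convex hull {a, b, c} \<subseteq> U"
    have swap: "contour_integral (linepath p q) ?I =
        contour_integral (circlepath 0 r) (\<lambda>z. contour_integral (linepath p q) (\<lambda>w. G w z))"
      and int: "(\<lambda>z. contour_integral (linepath p q) (\<lambda>w. G w z)) contour_integrable_on circlepath 0 r"
      if "closed_segment p q \<subseteq> U" for p q
    proof -
      have c: "continuous_on (closed_segment p q \<times> sphere 0 r) (\<lambda>(w, z). G w z)"
        using that by (intro continuous_on_subset[OF cont]) auto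
      show "contour_integral (linepath p q) ?I =
        contour_integral (circlepath 0 r) (\<lambda>z. contour_integral (linepath p q) (\<lambda>w. G w z))"
      proof (rule contour_integral_swap)
        show "continuous_on {0..1} (\<lambda>t. vector_derivative (circlepath 0 r) (at t))"
          unfolding vector_derivative_circlepath by (intro continuous_intros)
      qed (use c \<open>0 < r\<close> in auto)
      have "continuous_on (sphere 0 r) (\<lambda>z. integral (cbox 0 1) (\<lambda>t. G (linepath p q t) z * (q - p)))"
      proof (rule integral_continuous_on_param)
        have "continuous_on (sphere 0 r \<times> cbox 0 1) (\<lambda>y. (\<lambda>(w, z). G w z) (linepath p q (snd y), fst y))"
        proof (rule continuous_on_compose2[OF c])
          show "continuous_on (sphere 0 r \<times> cbox 0 1) (\<lambda>y. (linepath p q (snd y), fst y))"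
            unfolding linepath_def by (intro continuous_intros)
          show "(\<lambda>y. (linepath p q (snd y), fst y)) ` (sphere 0 r \<times> cbox 0 1) \<subseteq> closed_segment p q \<times> sphere 0 r"
            using path_image_linepath[of p q] unfolding path_image_def by auto
        qed
        then show "continuous_on (sphere 0 r \<times> cbox 0 1) (\<lambda>(z, t). G (linepath p q t) z * (q - p))"
          by (auto simp: case_prod_beta intro!: continuous_intros)
      qed
      then show "(\<lambda>z. contour_integral (linepath p q) (\<lambda>w. G w z)) contour_integrable_on circlepath 0 r"
        using \<open>0 < r\<close> by (intro contour_integrable_circlepath) (simp_all add: contour_integral_integral)
    qed
    have seg: "closed_segment a b \<subseteq> U" "closed_segment b c \<subseteq> U" "closed_segment c a \<subseteq> U"
      using sub by (meson hull_subset order_trans segments_subset_convex_hull)+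
    have "contour_integral (linepath a b) ?I +
        contour_integral (linepath b c) ?I + contour_integral (linepath c a) ?I =
        contour_integral (circlepath 0 r) (\<lambda>z. contour_integral (linepath a b) (\<lambda>w. G w z) +
          contour_integral (linepath b c) (\<lambda>w. G w z) + contour_integral (linepath c a) (\<lambda>w. G w z))"
      by (simp add: swap int seg contour_integral_add contour_integrable_add)
    also have "\<dots> = contour_integral (circlepath 0 r) (\<lambda>z. 0)"
    proof (rule contour_integral_eq)
      fix z assume "z \<in> path_image (circlepath 0 r)"
      then have z: "z \<in> sphere 0 r" using \<open>0 < r\<close> by simp
      have h: "(\<lambda>w. G w z) holomorphic_on convex hull {a, b, c}"
        by (rule holomorphic_on_subset[OF hol[OF z] sub])
      have i: "(\<lambda>w. G w z) contour_integrable_on linepath p q" if "closed_segment p q \<subseteq> U" for p q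
        using that by (intro contour_integrable_continuous_linepath
            continuous_on_subset[OF holomorphic_on_imp_continuous_on[OF hol[OF z]]])
      have "((\<lambda>w. G w z) has_contour_integral 0) (linepath a b +++ linepath b c +++ linepath c a)"
        by (rule Cauchy_theorem_triangle[OF h])
      then show "contour_integral (linepath a b) (\<lambda>w. G w z) + contour_integral (linepath b c) (\<lambda>w. G w z) +
          contour_integral (linepath c a) (\<lambda>w. G w z) = 0"
        by (rule has_chain_integral_chain_integral3)
    qed
    also have "\<dots> = 0" by simp
    finally show "contour_integral (linepath a b) ?I +
      contour_integral (linepath b c) ?I + contour_integral (linepath c a) ?I = 0" .
  qed
qed

text \<open>The last argument is the variable of integration. Holomorphy in the second parameter is
  the form of dependence that \<open>no_isolated_zero_bidisc\<close> takes as input.\<close>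

definition sep_holomorphic :: "real \<Rightarrow> (complex \<times> complex \<Rightarrow> complex \<Rightarrow> complex) \<Rightarrow> bool" where
  "sep_holomorphic R F \<longleftrightarrow>
     continuous_on ((ball 0 R \<times> ball 0 R) \<times> ball 0 R) (\<lambda>(p, z). F p z) \<and>
     (\<forall>p\<in>ball 0 R \<times> ball 0 R. F p holomorphic_on ball 0 R) \<and>
     (\<forall>x\<in>ball 0 R. \<forall>z\<in>ball 0 R. (\<lambda>y. F (x, y) z) holomorphic_on ball 0 R)"

text \<open>The Leibniz formula exhibits the determinant as a polynomial in the moments, so
  continuity and holomorphy pass from the moments to it.\<close>

lemma hankel_det_expand:
  "hankel_det r g k =
    (\<Sum>p | p permutes {0..<k}. signof p * (\<Prod>i=0..<k. moment r g (i + p i)))"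
proof -
  have "hankel_det r g k = (\<Sum>p | p permutes {0..<k}. signof p *
      (\<Prod>i=0..<k. Matrix.mat k k (\<lambda>(i, j). moment r g (i + j)) $$ (i, p i)))"
    unfolding hankel_det_def by (rule det_def') simp
  also have "\<dots> = (\<Sum>p | p permutes {0..<k}. signof p * (\<Prod>i=0..<k. moment r g (i + p i)))"
  proof (intro sum.cong refl arg_cong2[where f = "(*)"] prod.cong)
    fix p i assume "p \<in> {p. p permutes {0..<k}}" "i \<in> {0..<k}"
    then have "i < k" "p i < k" using permutes_in_image[of p "{0..<k}" i] by auto
    then show "Matrix.mat k k (\<lambda>(i, j). moment r g (i + j)) $$ (i, p i) = moment r g (i + p i)"
      by simp
  qed
  finally show ?thesis .
qed

lemma
  assumes F: "sep_holomorphic R F" and G: "sep_holomorphic R G"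
    and r: "0 < r" "r < R" and \<delta>: "\<delta> \<le> R"
    and nz: "\<And>p z. p \<in> ball 0 \<delta> \<times> ball 0 \<delta> \<Longrightarrow> z \<in> sphere 0 r \<Longrightarrow> G p z \<noteq> 0"
  shows continuous_on_hankel_det:
      "continuous_on (ball 0 \<delta> \<times> ball 0 \<delta>) (\<lambda>p. hankel_det r (\<lambda>z. F p z / G p z) k)"
    and holomorphic_on_hankel_det:
      "x \<in> ball 0 \<delta> \<Longrightarrow> (\<lambda>y. hankel_det r (\<lambda>z. F (x, y) z / G (x, y) z) k) holomorphic_on ball 0 \<delta>"
proof -
  let ?B = "ball 0 \<delta> \<times> ball 0 \<delta> :: (complex \<times> complex) set"
  have sub: "?B \<times> sphere 0 r \<subseteq> (ball 0 R \<times> ball 0 R) \<times> ball 0 R" using r \<delta> by auto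
  have c: "continuous_on (?B \<times> sphere 0 r) (\<lambda>y. case y of (p, z) \<Rightarrow> F p z)"
    "continuous_on (?B \<times> sphere 0 r) (\<lambda>y. case y of (p, z) \<Rightarrow> G p z)"
    using F G sub unfolding sep_holomorphic_def by (blast intro: continuous_on_subset)+
  have cm: "continuous_on (?B \<times> sphere 0 r) (\<lambda>(p, z). F p z / G p z * z ^ m)" for m
    using nz c unfolding case_prod_beta by (intro continuous_intros) auto
  show "continuous_on ?B (\<lambda>p. hankel_det r (\<lambda>z. F p z / G p z) k)"
    unfolding hankel_det_expand moment_def
    by (intro continuous_intros continuous_on_contour_integral_circlepath cm r)
  assume x: "x \<in> ball 0 \<delta>"
  have "(\<lambda>y. moment r (\<lambda>z. F (x, y) z / G (x, y) z) m) holomorphic_on ball 0 \<delta>" for m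
    unfolding moment_def
  proof (rule holomorphic_on_contour_integral_circlepath)
    have "continuous_on (ball 0 \<delta> \<times> sphere 0 r)
        (\<lambda>y. (\<lambda>(p, z). F p z / G p z * z ^ m) ((x, fst y), snd y))"
      by (rule continuous_on_compose2[OF cm]) (use x in \<open>auto intro!: continuous_intros\<close>)
    then show "continuous_on (ball 0 \<delta> \<times> sphere 0 r) (\<lambda>(y, z). F (x, y) z / G (x, y) z * z ^ m)"
      by (simp add: case_prod_beta)
    fix z :: complex assume z: "z \<in> sphere 0 r"
    have "x \<in> ball 0 R" "z \<in> ball 0 R" using x z r \<delta> by auto
    then have "(\<lambda>y. F (x, y) z) holomorphic_on ball 0 R" "(\<lambda>y. G (x, y) z) holomorphic_on ball 0 R"
      using F G unfolding sep_holomorphic_def by blast+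
    then have "(\<lambda>y. F (x, y) z) holomorphic_on ball 0 \<delta>" "(\<lambda>y. G (x, y) z) holomorphic_on ball 0 \<delta>"
      using \<delta> by (meson holomorphic_on_subset subset_ball)+
    then show "(\<lambda>y. F (x, y) z / G (x, y) z * z ^ m) holomorphic_on ball 0 \<delta>"
      using nz x z by (intro holomorphic_intros) auto
  qed (use r in auto)
  then show "(\<lambda>y. hankel_det r (\<lambda>z. F (x, y) z / G (x, y) z) k) holomorphic_on ball 0 \<delta>"
    unfolding hankel_det_expand by (intro holomorphic_intros)
qed

section \<open>Functions of two variables have no isolated zeros\<close>

lemma minimum_modulus_cball:
  fixes f :: "complex \<Rightarrow> complex"
  assumes f: "f holomorphic_on ball 0 \<delta>" and nz: "\<And>y. y \<in> ball 0 \<delta> \<Longrightarrow> f y \<noteq> 0"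
    and s: "0 < s" "s < \<delta>" and m: "0 < m" "\<And>y. y \<in> sphere 0 s \<Longrightarrow> m \<le> norm (f y)"
  shows "m \<le> norm (f 0)"
proof -
  have sub: "cball (0::complex) s \<subseteq> ball 0 \<delta>" using s by auto
  have hol: "(\<lambda>y. 1 / f y) holomorphic_on cball 0 s"
    using nz sub by (intro holomorphic_intros holomorphic_on_subset[OF f]) auto
  have "norm (1 / f 0) \<le> 1 / m"
  proof (rule maximum_modulus_frontier[where f = "\<lambda>y. 1 / f y" and S = "ball 0 s"])
    show "(\<lambda>y. 1 / f y) holomorphic_on interior (ball 0 s)"
      by (rule holomorphic_on_subset[OF hol]) auto
    show "continuous_on (closure (ball 0 s)) (\<lambda>y. 1 / f y)"
      using holomorphic_on_imp_continuous_on[OF hol] s by simp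
    fix z :: complex assume "z \<in> frontier (ball 0 s)"
    then have "m \<le> norm (f z)" using m(2) s by simp
    then show "norm (1 / f z) \<le> 1 / m"
      using m(1) by (simp add: norm_divide frac_le)
  qed (use s in auto)
  moreover have "f 0 \<noteq> 0" using nz[of 0] s by simp
  ultimately show ?thesis using m(1) by (simp add: norm_divide field_simps)
qed

text \<open>For small \<open>x \<noteq> 0\<close> the slice \<open>D (x, _)\<close> has no zeros, so
  the minimum principle carries a lower bound from the circle of radius \<open>s\<close>, uniform in
  \<open>x\<close>, to \<open>D (x, 0)\<close>. Then \<open>x\<close> tends to 0.\<close>

lemma no_isolated_zero_bidisc:
  fixes D :: "complex \<times> complex \<Rightarrow> complex"
  assumes "0 < \<delta>" and cont: "continuous_on (ball 0 \<delta> \<times> ball 0 \<delta>) D"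
    and hol: "\<And>x. x \<in> ball 0 \<delta> \<Longrightarrow> (\<lambda>y. D (x, y)) holomorphic_on ball 0 \<delta>"
    and nz: "\<And>p. p \<in> ball 0 \<delta> \<times> ball 0 \<delta> \<Longrightarrow> p \<noteq> 0 \<Longrightarrow> D p \<noteq> 0"
  shows "D (0, 0) \<noteq> 0"
proof -
  define s where "s = \<delta> / 2"
  have s: "0 < s" "s < \<delta>" using \<open>0 < \<delta>\<close> by (auto simp: s_def)
  have c: "continuous_on (ball 0 \<delta> \<times> sphere 0 s) D"
    by (rule continuous_on_subset[OF cont]) (use s in auto)
  have "continuous_on (sphere 0 s) (\<lambda>y. norm (D (0, y)))"
    by (intro continuous_on_norm continuous_on_compose2[OF c]) (use s in \<open>auto intro!: continuous_intros\<close>)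
  moreover have "of_real s \<in> sphere (0::complex) s" using s by simp
  ultimately obtain y0 where y0: "y0 \<in> sphere 0 s"
    and min: "\<And>y. y \<in> sphere 0 s \<Longrightarrow> norm (D (0, y0)) \<le> norm (D (0, y))"
    using continuous_attains_inf[of "sphere 0 s" "\<lambda>y. norm (D (0, y))"] compact_sphere
    by (metis empty_iff)
  \<comment> \<open>Half the minimum on the slice \<open>x = 0\<close>: a perturbation by at most
    \<open>m\<close> leaves the bound \<open>m\<close>.\<close>
  define m where "m = norm (D (0, y0)) / 2"
  have "m > 0" unfolding m_def using nz[of "(0, y0)"] y0 s by (auto simp: zero_prod_def)
  obtain X where X: "0 \<in> X" "open X"
    and close: "\<And>x y. x \<in> X \<inter> ball 0 \<delta> \<Longrightarrow> y \<in> sphere 0 s \<Longrightarrow> dist (D (x, y)) (D (0, y)) \<le> m"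
    using continuous_on_prod_compactE[OF c compact_sphere, of 0 m] \<open>m > 0\<close> \<open>0 < \<delta>\<close> by (metis centre_in_ball)
  have bound: "m \<le> norm (D (x, 0))" if "x \<in> X \<inter> ball 0 \<delta>" "x \<noteq> 0" for x
  proof (rule minimum_modulus_cball[where f = "\<lambda>y. D (x, y)", OF hol _ s \<open>m > 0\<close>])
    fix y :: complex assume y: "y \<in> sphere 0 s"
    have "norm (D (0, y)) \<le> norm (D (x, y)) + m"
      using close[OF that(1) y] norm_triangle_ineq3[of "D (0, y)" "D (x, y)"]
      by (simp add: dist_norm norm_minus_commute)
    then show "m \<le> norm (D (x, y))" using min[OF y] by (simp add: m_def)
  qed (use that nz in \<open>auto simp: zero_prod_def\<close>)
  have "continuous_on (ball 0 \<delta>) (\<lambda>x. norm (D (x, 0)))"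
    by (intro continuous_on_norm continuous_on_compose2[OF cont]) (use \<open>0 < \<delta>\<close> in \<open>auto intro!: continuous_intros\<close>)
  then have "((\<lambda>x. norm (D (x, 0))) \<longlongrightarrow> norm (D (0, 0))) (at 0)"
    using \<open>0 < \<delta>\<close> by (simp add: continuous_on_eq_continuous_at isCont_def)
  moreover have "eventually (\<lambda>x. x \<in> X \<inter> ball 0 \<delta> \<and> x \<noteq> 0) (at 0)"
    using X \<open>0 < \<delta>\<close> unfolding eventually_at_topological by (intro exI[of _ "X \<inter> ball 0 \<delta>"]) auto
  then have "eventually (\<lambda>x. m \<le> norm (D (x, 0))) (at 0)"
    by (rule eventually_mono) (use bound in blast)
  ultimately have "m \<le> norm (D (0, 0))"
    by (rule tendsto_lowerbound) simp
  then show ?thesis using \<open>m > 0\<close> by auto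
qed

subsection \<open>Quadruples with \<open>f\<^sub>1 f\<^sub>4 = f\<^sub>2 f\<^sub>3\<close> in one variable\<close>

lemma holomorphic_on_ball_imp_analytic_on_cball:
  "f holomorphic_on ball 0 R \<Longrightarrow> r < R \<Longrightarrow> f analytic_on cball (0::complex) r"
  by (rule analytic_on_subset[of _ "ball 0 R"]) (auto simp: analytic_on_open)

text \<open>
  The unique \<open>j\<close> is the number of poles of \<open>f2 / f1\<close>: without common zeros of the four functions,
  the poles of \<open>f2 / f1\<close> and of \<open>f3 / f1\<close> together make up the zeros of \<open>f1\<close>.
\<close>

lemma hankel_dets_of_determinantal_quadruple:
  assumes r: "0 < r"
    and f: "f2 analytic_on cball 0 r" "f3 analytic_on cball 0 r" "f4 analytic_on cball 0 r"
    and Q: "Q \<noteq> 0" "\<And>z. poly Q z = 0 \<Longrightarrow> z \<in> ball 0 r"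
    and u: "u analytic_on cball 0 r" "\<And>z. z \<in> cball 0 r \<Longrightarrow> u z \<noteq> 0"
    and f1: "\<And>z. f1 z = poly Q z * u z"
    and eq: "\<And>z. z \<in> cball 0 r \<Longrightarrow> f1 z * f4 z = f2 z * f3 z"
    and nz: "\<And>z. z \<in> cball 0 r \<Longrightarrow> f1 z \<noteq> 0 \<or> f2 z \<noteq> 0 \<or> f3 z \<noteq> 0 \<or> f4 z \<noteq> 0"
  shows "\<exists>!j. j \<le> degree Q \<and> hankel_det r (\<lambda>z. f2 z / f1 z) j \<noteq> 0 \<and>
    hankel_det r (\<lambda>z. f3 z / f1 z) (degree Q - j) \<noteq> 0"
proof -
  have Qc: "z \<in> cball 0 r" if "poly Q z = 0" for z using Q(2)[OF that] by auto
  have "\<exists>a d b e. Q = a * d \<and> b analytic_on cball 0 r \<and> e analytic_on cball 0 r \<and>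
    (\<forall>z\<in>cball 0 r. f2 z = poly d z * b z \<and> f3 z = poly a z * e z) \<and>
    (\<forall>z. poly a z = 0 \<longrightarrow> b z \<noteq> 0) \<and> (\<forall>z. poly d z = 0 \<longrightarrow> e z \<noteq> 0)"
  proof (rule split_poly_divisor[OF r Q(1) Qc f(1,2)])
    show "(\<lambda>z. u z * f4 z) analytic_on cball 0 r" by (intro analytic_intros u f)
    show "f2 z * f3 z = poly Q z * (u z * f4 z)" if "z \<in> cball 0 r" for z
      using eq[OF that] by (simp add: f1 mult.assoc)
    show "f2 z \<noteq> 0 \<or> f3 z \<noteq> 0 \<or> u z * f4 z \<noteq> 0" if "poly Q z = 0" for z
      using nz[OF Qc[OF that]] u(2)[OF Qc[OF that]] that by (auto simp: f1)
  qed
  then obtain a d b e where Qad: "Q = a * d"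
    and b: "b analytic_on cball 0 r" and e: "e analytic_on cball 0 r"
    and f23: "\<forall>z\<in>cball 0 r. f2 z = poly d z * b z \<and> f3 z = poly a z * e z"
    and bnz: "\<forall>z. poly a z = 0 \<longrightarrow> b z \<noteq> 0" and enz: "\<forall>z. poly d z = 0 \<longrightarrow> e z \<noteq> 0"
    by (elim exE conjE) (rule that)
  have f2: "f2 z = poly d z * b z" and f3: "f3 z = poly a z * e z" if "z \<in> cball 0 r" for z
    using f23 that by auto
  have ad: "a \<noteq> 0" "d \<noteq> 0" using Qad Q(1) by auto
  have deg: "degree Q = degree a + degree d" using ad by (simp add: Qad degree_mult_eq)
  have roots: "z \<in> ball 0 r" if "poly a z = 0 \<or> poly d z = 0" for z
    using Q(2)[of z] that by (auto simp: Qad)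
  have f1nz: "f1 z \<noteq> 0" if "z \<in> sphere 0 r" for z
  proof -
    have "poly Q z \<noteq> 0" using Q(2)[of z] that by auto
    then show ?thesis using u(2)[of z] that by (simp add: f1)
  qed
  let ?g = "\<lambda>z. f2 z / f1 z" and ?h = "\<lambda>z. f3 z / f1 z"
  \<comment> \<open>After cancelling \<open>d\<close> the quotient is \<open>b / (a u)\<close> with
    \<open>b\<close> and \<open>u\<close> nonzero at the roots of \<open>a\<close>, so it has
    exactly \<open>degree a\<close> poles. The same holds for \<open>?h\<close> with
    \<open>e\<close> and \<open>d\<close>.\<close>
  have g: "?g z * poly a z = b z / u z" if "z \<in> sphere 0 r" for z
    using f1nz[OF that] f2[of z] that by (simp add: f1 Qad)
  have h: "?h z * poly d z = e z / u z" if "z \<in> sphere 0 r" for z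
    using f1nz[OF that] f3[of z] that by (simp add: f1 Qad)
  have bu: "(\<lambda>z. b z / u z) analytic_on cball 0 r" "(\<lambda>z. e z / u z) analytic_on cball 0 r"
    using u(2) by (intro analytic_intros b e u; simp)+
  have ug: "hankel_det r ?g (degree a) \<noteq> 0" "hankel_det r ?h (degree d) \<noteq> 0"
    using roots u(2) bnz enz
    by (intro hankel_det_neq_0[OF r ad(1) _ bu(1) _ g] hankel_det_neq_0[OF r ad(2) _ bu(2) _ h]; force)+
  have "f1 = (\<lambda>z. poly Q z * u z)" using f1 by auto
  then have "f1 analytic_on cball 0 r" using u(1) by (auto intro!: analytic_intros)
  then have f': "f1 analytic_on sphere 0 r" "f2 analytic_on sphere 0 r" "f3 analytic_on sphere 0 r"
    using f by (meson analytic_on_subset sphere_cball)+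
  have c: "continuous_on (sphere 0 r) ?g" "continuous_on (sphere 0 r) ?h"
    using f1nz by (intro analytic_imp_continuous_on analytic_intros f'; simp)+
  \<comment> \<open>Above the number of poles the determinants vanish. As the two bounds add up to
    \<open>degree Q\<close>, both are attained at the admissible \<open>j\<close>.\<close>
  have le: "j \<le> degree a" if "hankel_det r ?g j \<noteq> 0" for j
    using hankel_det_eq_0[OF c(1) r ad(1) _ bu(1) g] that by (meson not_le)
  have le': "j \<le> degree d" if "hankel_det r ?h j \<noteq> 0" for j
    using hankel_det_eq_0[OF c(2) r ad(2) _ bu(2) h] that by (meson not_le)
  show ?thesis
  proof (rule ex1I[of _ "degree a"])
    show "degree a \<le> degree Q \<and> hankel_det r ?g (degree a) \<noteq> 0 \<and>
      hankel_det r ?h (degree Q - degree a) \<noteq> 0" using ug deg by simp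
    fix j assume j: "j \<le> degree Q \<and> hankel_det r ?g j \<noteq> 0 \<and> hankel_det r ?h (degree Q - j) \<noteq> 0"
    then have "j \<le> degree a" "degree Q - j \<le> degree d" using le le' by auto
    then show "j = degree a" using deg j by linarith
  qed
qed

text \<open>
  If both determinants were nonzero, \<open>f2\<close> and \<open>f3\<close> would vanish at \<open>0\<close> to total order at most \<open>N\<close>,
  whereas \<open>f1 * f4\<close> vanishes to order at least \<open>N + 1\<close>.
\<close>

lemma hankel_dets_of_vanishing_quadruple:
  assumes r: "0 < r" "r < R" and f: "f2 holomorphic_on ball 0 R" "f3 holomorphic_on ball 0 R"
      "f4 holomorphic_on ball 0 R"
    and g: "g holomorphic_on ball 0 R" "\<And>z. z \<in> cball 0 r \<Longrightarrow> g z \<noteq> 0"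
    and f1: "\<And>z. f1 z = z ^ N * g z"
    and eq: "\<And>z. z \<in> cball 0 r \<Longrightarrow> f1 z * f4 z = f2 z * f3 z"
    and 0: "f1 0 = 0" "f2 0 = 0" "f3 0 = 0" "f4 0 = 0"
    and k: "k \<le> N"
  shows "hankel_det r (\<lambda>z. f2 z / f1 z) k = 0 \<or> hankel_det r (\<lambda>z. f3 z / f1 z) (N - k) = 0"
proof (rule ccontr)
  assume H: "\<not> ?thesis"
  have ana: "g analytic_on cball 0 r" "f2 analytic_on cball 0 r" "f3 analytic_on cball 0 r"
      "f4 analytic_on cball 0 r"
    using f g r by (auto intro: holomorphic_on_ball_imp_analytic_on_cball)
  have "N \<ge> 1" using 0(1) f1[of 0] g(2)[of 0] r by (cases N) auto
  \<comment> \<open>If \<open>z^(N-j+1)\<close> divided \<open>h\<close>, then \<open>h / f1\<close>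
    would have a pole of order at most \<open>j - 1\<close>, which \<open>z^(j-1)\<close> clears,
    and the \<open>j\<close>-th determinant would vanish.\<close>
  have not_dvd: "\<nexists>w. w analytic_on cball 0 r \<and> (\<forall>z\<in>cball 0 r. h z = z ^ (N - j + 1) * w z)"
    if j: "1 \<le> j" "j \<le> N" and Hj: "hankel_det r (\<lambda>z. h z / f1 z) j \<noteq> 0"
      and h: "h analytic_on cball 0 r" for h j
  proof
    assume "\<exists>w. w analytic_on cball 0 r \<and> (\<forall>z\<in>cball 0 r. h z = z ^ (N - j + 1) * w z)"
    then obtain w where w: "w analytic_on cball 0 r"
      "\<And>z. z \<in> cball 0 r \<Longrightarrow> h z = z ^ (N - j + 1) * w z" by blast
    have f1nz: "f1 z \<noteq> 0" if "z \<in> sphere 0 r" for z using f1[of z] g(2)[of z] that r by auto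
    have "hankel_det r (\<lambda>z. h z / f1 z) j = 0"
    proof (rule hankel_det_eq_0[where p = "monom 1 (j - 1)"])
      have "f1 = (\<lambda>z. z ^ N * g z)" using f1 by auto
      then have "f1 analytic_on cball 0 r" using ana(1) by (auto intro!: analytic_intros)
      then have "f1 analytic_on sphere 0 r" "h analytic_on sphere 0 r"
        using h by (meson analytic_on_subset sphere_cball)+
      then show "continuous_on (sphere 0 r) (\<lambda>z. h z / f1 z)"
        using f1nz by (intro analytic_imp_continuous_on analytic_intros) auto
      show "degree (monom (1::complex) (j - 1)) < j" using j by (simp add: degree_monom_eq)
      show "(\<lambda>z. w z / g z) analytic_on cball 0 r"
        using g(2) by (intro analytic_intros w ana) auto
      fix z :: complex assume z: "z \<in> sphere 0 r"
      have "N - j + 1 + (j - 1) = N" using j by simp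
      then have "z ^ (N - j + 1) * z ^ (j - 1) = z ^ N" by (metis power_add)
      then have "h z * z ^ (j - 1) = z ^ N * w z" using w(2)[of z] z by (simp add: mult_ac)
      then have "h z / f1 z * z ^ (j - 1) = (z ^ N * w z) / (z ^ N * g z)" using f1[of z] by simp
      then show "h z / f1 z * poly (monom 1 (j - 1)) z = w z / g z"
        using z r by (auto simp: poly_monom)
    qed (use r in auto)
    then show False using Hj by simp
  qed
  obtain w2 where w2: "w2 analytic_on cball 0 r" "\<And>z. f2 z = z * w2 z"
    using analytic_factor_root[OF ana(2) 0(2)] by auto
  obtain w3 where w3: "w3 analytic_on cball 0 r" "\<And>z. f3 z = z * w3 z"
    using analytic_factor_root[OF ana(3) 0(3)] by auto
  obtain w4 where w4: "w4 analytic_on cball 0 r" "\<And>z. f4 z = z * w4 z"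
    using analytic_factor_root[OF ana(4) 0(4)] by auto
  have nd2: "\<nexists>w. w analytic_on cball 0 r \<and> (\<forall>z\<in>cball 0 r. f2 z = z ^ (N - k + 1) * w z)" if "1 \<le> k"
    by (rule not_dvd[OF that k _ ana(2)]) (use H in simp)
  have nd3: "\<nexists>w. w analytic_on cball 0 r \<and> (\<forall>z\<in>cball 0 r. f3 z = z ^ (k + 1) * w z)" if "k < N"
    using not_dvd[OF _ _ _ ana(3), of "N - k"] H that k by simp
  \<comment> \<open>In the extreme cases \<open>k = 0\<close> and \<open>k = N\<close> the forbidden
    divisor is \<open>z\<close> itself, yet \<open>f3\<close> and \<open>f2\<close> vanish at
    0.\<close>
  have "k \<noteq> 0"
    using nd3 w3 \<open>N \<ge> 1\<close> by fastforce
  moreover have "k \<noteq> N"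
    using nd2 w2 \<open>N \<ge> 1\<close> by fastforce
  ultimately have k1: "1 \<le> k" "k < N" using k by auto
  have R: "0 \<in> ball (0::complex) R" using r by simp
  \<comment> \<open>The zero function would be divisible by every power of \<open>z\<close>; hence
    the order of \<open>f2\<close> at 0 is finite.\<close>
  have "\<exists>z\<in>ball 0 R. f2 z \<noteq> 0"
  proof (rule ccontr)
    assume "\<not> ?thesis"
    then have "\<forall>z\<in>cball 0 r. f2 z = z ^ (N - k + 1) * 0" using r by auto
    then show False using nd2[OF k1(1)] by (metis analytic_on_const)
  qed
  then obtain m2 b2 where b2: "b2 holomorphic_on ball 0 R" "b2 0 \<noteq> 0" "\<And>z. f2 z = z ^ m2 * b2 z"
    using holomorphic_factor_power[OF f(1) R] by (metis diff_zero)
  have "\<exists>z\<in>ball 0 R. f3 z \<noteq> 0"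
  proof (rule ccontr)
    assume "\<not> ?thesis"
    then have "\<forall>z\<in>cball 0 r. f3 z = z ^ (k + 1) * 0" using r by auto
    then show False using nd3[OF k1(2)] by (metis analytic_on_const)
  qed
  then obtain m3 b3 where b3: "b3 holomorphic_on ball 0 R" "b3 0 \<noteq> 0" "\<And>z. f3 z = z ^ m3 * b3 z"
    using holomorphic_factor_power[OF f(2) R] by (metis diff_zero)
  have b: "b2 analytic_on cball 0 r" "b3 analytic_on cball 0 r"
    using b2 b3 r by (auto intro: holomorphic_on_ball_imp_analytic_on_cball)
  have "m2 \<le> N - k"
  proof (rule ccontr)
    assume "\<not> ?thesis"
    then have "f2 z = z ^ (N - k + 1) * (z ^ (m2 - (N - k + 1)) * b2 z)" for z
      using b2(3)[of z] by (simp add: power_add[symmetric] mult.assoc[symmetric] del: power_Suc)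
    moreover have "(\<lambda>z. z ^ (m2 - (N - k + 1)) * b2 z) analytic_on cball 0 r"
      by (intro analytic_intros b)
    ultimately show False using nd2[OF k1(1)] by blast
  qed
  moreover have "m3 \<le> k"
  proof (rule ccontr)
    assume "\<not> ?thesis"
    then have "f3 z = z ^ (k + 1) * (z ^ (m3 - (k + 1)) * b3 z)" for z
      using b3(3)[of z] by (simp add: power_add[symmetric] mult.assoc[symmetric] del: power_Suc)
    moreover have "(\<lambda>z. z ^ (m3 - (k + 1)) * b3 z) analytic_on cball 0 r"
      by (intro analytic_intros b)
    ultimately show False using nd3[OF k1(2)] by blast
  qed
  ultimately have m: "m2 + m3 \<le> N" using k by linarith
  \<comment> \<open>The excess of the order \<open>N + 1\<close>, to which \<open>f4 0 = 0\<close>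
    contributes the 1, over that of \<open>f2 f3\<close>. After cancellation a positive power of
    \<open>z\<close> remains on one side only, which is absurd at 0.\<close>
  define l where "l = N + 1 - (m2 + m3)"
  have l: "N + 1 = m2 + m3 + l" "l \<noteq> 0" using m by (auto simp: l_def)
  have "b2 0 * b3 0 = 0 ^ l * (g 0 * w4 0)"
  proof (rule poly_mult_cancel_on_cball[where d = "monom 1 (m2 + m3)" and f = "\<lambda>z. b2 z * b3 z"
        and g = "\<lambda>z. z ^ l * (g z * w4 z)", OF r(1)])
    fix z :: complex assume z: "z \<in> cball 0 r"
    have "z ^ (m2 + m3) * (b2 z * b3 z) = f2 z * f3 z"
      by (simp add: b2(3) b3(3) power_add mult_ac)
    also have "\<dots> = z ^ (N + 1) * (g z * w4 z)"
      using eq[OF z] by (simp add: f1 w4(2) mult_ac)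
    also have "\<dots> = z ^ (m2 + m3) * (z ^ l * (g z * w4 z))"
      unfolding l(1) by (simp add: power_add mult_ac)
    finally show "poly (monom 1 (m2 + m3)) z * (b2 z * b3 z) =
      poly (monom 1 (m2 + m3)) z * (z ^ l * (g z * w4 z))" by (simp add: poly_monom)
  qed (use r in \<open>auto intro!: analytic_intros b ana w4\<close>)
  then show False using b2(2) b3(2) l(2) by (simp add: zero_power)
qed

subsection \<open>No isolated common zero in three variables\<close>

text \<open>\<open>regular\<close> places every zero of \<open>F1 0\<close> at the origin and so
  fixes \<open>N\<close>; \<open>isolated\<close> makes the pole counts add up to \<open>N\<close>
  at every other parameter near 0.\<close>

lemma no_isolated_zero_of_determinantal_quadruple:
  fixes F1 F2 F3 F4 :: "complex \<times> complex \<Rightarrow> complex \<Rightarrow> complex"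
  assumes "0 < R"
    and F: "sep_holomorphic R F1" "sep_holomorphic R F2" "sep_holomorphic R F3" "sep_holomorphic R F4"
    and eq: "\<And>p z. p \<in> ball 0 R \<times> ball 0 R \<Longrightarrow> z \<in> ball 0 R \<Longrightarrow> F1 p z * F4 p z = F2 p z * F3 p z"
    and zero: "F1 0 0 = 0" "F2 0 0 = 0" "F3 0 0 = 0" "F4 0 0 = 0"
    and isolated: "\<And>p z. p \<in> ball 0 R \<times> ball 0 R \<Longrightarrow> z \<in> ball 0 R \<Longrightarrow> p \<noteq> 0 \<Longrightarrow>
      F1 p z \<noteq> 0 \<or> F2 p z \<noteq> 0 \<or> F3 p z \<noteq> 0 \<or> F4 p z \<noteq> 0"
    and regular: "\<And>z. z \<in> ball 0 R \<Longrightarrow> z \<noteq> 0 \<Longrightarrow> F1 0 z \<noteq> 0"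
  shows False
proof -
  define r where "r = R / 2"
  have r: "0 < r" "r < R" using \<open>0 < R\<close> by (auto simp: r_def)
  have hol: "F p holomorphic_on ball 0 R"
    if "sep_holomorphic R F" "p \<in> ball 0 R \<times> ball 0 R" for F p
    using that unfolding sep_holomorphic_def by blast
  have origin: "0 \<in> ball (0::complex) R \<times> ball (0::complex) R"
    using \<open>0 < R\<close> by (auto simp: zero_prod_def)
  have R: "0 \<in> ball (0::complex) R" "of_real r \<in> ball (0::complex) R" "F1 0 (of_real r) \<noteq> 0"
    using r regular[of "of_real r"] by auto
  obtain N g where g: "g holomorphic_on ball 0 R" "g 0 \<noteq> 0" "\<And>z. F1 0 z = z ^ N * g z"
    using holomorphic_factor_power[OF hol[OF F(1) origin] R] by (metis diff_zero)
  have gnz: "g z \<noteq> 0" if "z \<in> cball 0 r" for z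
    using g(2) g(3)[of z] regular[of z] that r by (cases "z = 0") auto
  have c1: "continuous_on ((ball 0 R \<times> ball 0 R) \<times> sphere 0 r) (\<lambda>y. case y of (p, z) \<Rightarrow> F1 p z)"
    using F(1) r unfolding sep_holomorphic_def by (auto intro: continuous_on_subset)
  have "continuous_on (sphere 0 r) (\<lambda>z. norm (F1 0 z))"
    using hol[OF F(1) origin] r
    by (intro continuous_on_norm holomorphic_on_imp_continuous_on) (auto elim: holomorphic_on_subset)
  moreover have "of_real r \<in> sphere (0::complex) r" using r by simp
  ultimately obtain z0 where z0: "z0 \<in> sphere 0 r"
    and min: "\<And>z. z \<in> sphere 0 r \<Longrightarrow> norm (F1 0 z0) \<le> norm (F1 0 z)"
    using continuous_attains_inf[of "sphere 0 r" "\<lambda>z. norm (F1 0 z)"] compact_sphere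
    by (metis empty_iff)
  \<comment> \<open>Half the minimum, so that a deviation of at most \<open>m\<close> satisfies the
    strict inequality in Rouche's theorem.\<close>
  define m where "m = norm (F1 0 z0) / 2"
  have "m > 0" unfolding m_def using regular[of z0] z0 r by auto
  obtain X where X: "0 \<in> X" "open X" and close:
    "\<And>p z. p \<in> X \<inter> (ball 0 R \<times> ball 0 R) \<Longrightarrow> z \<in> sphere 0 r \<Longrightarrow> dist (F1 p z) (F1 0 z) \<le> m"
    using continuous_on_prod_compactE[OF c1 compact_sphere origin \<open>m > 0\<close>]
    by (metis (no_types, lifting) case_prod_conv Int_iff)
  obtain A B :: "complex set" where AB: "open A" "open B" "0 \<in> A \<times> B" "A \<times> B \<subseteq> X"
    using open_prod_elim[OF X(2,1)] by blast
  have "0 \<in> A" "0 \<in> B" using AB(3) by (auto simp: zero_prod_def)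
  then obtain \<alpha> \<beta> where \<alpha>\<beta>: "0 < \<alpha>" "ball 0 \<alpha> \<subseteq> A" "0 < \<beta>" "ball 0 \<beta> \<subseteq> B"
    using AB(1,2) by (metis open_contains_ball)
  define \<delta> where "\<delta> = min R (min \<alpha> \<beta>)"
  let ?B = "ball 0 \<delta> \<times> ball 0 \<delta> :: (complex \<times> complex) set"
  have \<delta>: "0 < \<delta>" "\<delta> \<le> R" using \<alpha>\<beta> \<open>0 < R\<close> by (auto simp: \<delta>_def)
  have "ball 0 \<delta> \<subseteq> ball 0 \<alpha>" "ball 0 \<delta> \<subseteq> ball 0 \<beta>" by (auto simp: \<delta>_def)
  then have BX: "?B \<subseteq> X" using \<alpha>\<beta> AB(4) by blast
  have BR: "?B \<subseteq> ball 0 R \<times> ball 0 R" using \<delta> by auto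
  have rouche: "norm (F1 p z - F1 0 z) < norm (F1 0 z)" if "p \<in> ?B" "z \<in> sphere 0 r" for p z
  proof -
    have "p \<in> X \<inter> (ball 0 R \<times> ball 0 R)" using that BX BR by blast
    then have "norm (F1 p z - F1 0 z) \<le> m" using close that(2) by (metis dist_norm)
    then show ?thesis using min[OF that(2)] \<open>m > 0\<close> unfolding m_def by linarith
  qed
  then have F1nz: "F1 p z \<noteq> 0" if "p \<in> ?B" "z \<in> sphere 0 r" for p z
    using that by fastforce
  define G where "G p = hankel_det r (\<lambda>z. F2 p z / F1 p z)" for p
  define H where "H p = hankel_det r (\<lambda>z. F3 p z / F1 p z)" for p
  have contG: "continuous_on ?B (\<lambda>p. G p k)" and contH: "continuous_on ?B (\<lambda>p. H p k)" for k
    unfolding G_def H_def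
    by (rule continuous_on_hankel_det[OF _ F(1) r \<delta>(2) F1nz]; use F in simp)+
  have unique: "\<exists>!j. j \<le> N \<and> G p j \<noteq> 0 \<and> H p (N - j) \<noteq> 0" if p: "p \<in> ?B" "p \<noteq> 0" for p
  proof -
    have pR: "p \<in> ball 0 R \<times> ball 0 R" using p(1) BR by blast
    obtain Q u where Q: "Q \<noteq> 0" "\<And>z. poly Q z = 0 \<Longrightarrow> z \<in> ball 0 r" and u: "u holomorphic_on ball 0 R"
      "\<And>z. z \<in> cball 0 r \<Longrightarrow> u z \<noteq> 0" "\<And>z. F1 p z = poly Q z * u z"
      using holomorphic_eq_poly_mult_nonzero[OF hol[OF F(1) pR] r F1nz[OF p(1)]] by blast
    \<comment> \<open>Rouche compares \<open>F1 p\<close> with \<open>F1 0 = z^N g\<close>, where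
      \<open>g\<close> is zero-free on the closed disc.\<close>
    have "degree Q = degree (monom (1::complex) N)"
    proof (rule degree_eq_if_close_on_sphere[OF r(1) Q(1) _ Q(2)])
      show "u analytic_on cball 0 r" "g analytic_on cball 0 r"
        using u(1) g(1) r(2) by (auto intro: holomorphic_on_ball_imp_analytic_on_cball)
      fix z :: complex assume "z \<in> sphere 0 r"
      then show "norm (poly Q z * u z - poly (monom 1 N) z * g z) < norm (poly (monom 1 N) z * g z)"
        using rouche[OF p(1)] by (simp add: u(3) g(3) poly_monom)
    qed (use r u(2) gnz in \<open>auto simp: poly_monom\<close>)
    then have N: "N = degree Q" by (simp add: degree_monom_eq)
    show ?thesis unfolding N G_def H_def
    proof (rule hankel_dets_of_determinantal_quadruple[OF r(1) _ _ _ Q _ u(2,3)])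
      show "F2 p analytic_on cball 0 r" "F3 p analytic_on cball 0 r" "F4 p analytic_on cball 0 r"
        "u analytic_on cball 0 r"
        using hol[OF _ pR] F u(1) r(2) by (auto intro: holomorphic_on_ball_imp_analytic_on_cball)
      fix z :: complex assume "z \<in> cball 0 r"
      then have "z \<in> ball 0 R" using r by auto
      then show "F1 p z * F4 p z = F2 p z * F3 p z"
        "F1 p z \<noteq> 0 \<or> F2 p z \<noteq> 0 \<or> F3 p z \<noteq> 0 \<or> F4 p z \<noteq> 0"
        using eq[OF pR] isolated[OF pR _ p(2)] by auto
    qed
  qed
  \<comment> \<open>The number of poles of \<open>F2 p / F1 p\<close> inside the circle.\<close>
  define \<kappa> where "\<kappa> p = (THE j. j \<le> N \<and> G p j \<noteq> 0 \<and> H p (N - j) \<noteq> 0)" for p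
  have \<kappa>: "\<kappa> p \<le> N" "G p (\<kappa> p) \<noteq> 0" "H p (N - \<kappa> p) \<noteq> 0" if "p \<in> ?B" "p \<noteq> 0" for p
    using theI'[OF unique[OF that]] unfolding \<kappa>_def by auto
  have \<kappa>I: "\<kappa> p = j" if "p \<in> ?B" "p \<noteq> 0" "j \<le> N" "G p j \<noteq> 0" "H p (N - j) \<noteq> 0" for p j
    using unique[OF that(1,2)] \<kappa>[OF that(1,2)] that(3-5) by blast
  let ?S = "?B - {0}"
  have openB: "open ?B" by (intro open_Times) auto
  have conn: "connected ?S"
    by (rule connected_open_delete[OF openB])
       (auto intro!: convex_connected convex_Times)
  define p0 where "p0 = (of_real (\<delta> / 2) :: complex, 0 :: complex)"
  have p0: "p0 \<in> ?S" using \<delta> by (auto simp: p0_def zero_prod_def)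
  have const: "\<kappa> p = \<kappa> p0" if "p \<in> ?S" for p
  \<comment> \<open>Both determinants stay nonzero near \<open>a\<close>, and uniqueness then forces
    the same index there.\<close>
  proof (rule connected_local_const[OF conn that p0])
    show "\<forall>a\<in>?S. eventually (\<lambda>b. \<kappa> a = \<kappa> b) (at a within ?S)"
    proof
      fix a assume a: "a \<in> ?S"
      have tG: "((\<lambda>p. G p k) \<longlongrightarrow> G a k) (at a within ?S)" and tH: "((\<lambda>p. H p k) \<longlongrightarrow> H a k) (at a within ?S)" for k
        using a continuous_on_subset[OF contG[of k], of ?S] continuous_on_subset[OF contH[of k], of ?S]
        unfolding continuous_on_def by auto
      have "eventually (\<lambda>p. G p (\<kappa> a) \<noteq> 0) (at a within ?S)"
        "eventually (\<lambda>p. H p (N - \<kappa> a) \<noteq> 0) (at a within ?S)"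
        using tendsto_imp_eventually_ne[OF tG] tendsto_imp_eventually_ne[OF tH] \<kappa>[of a] a by auto
      moreover have "eventually (\<lambda>p. p \<in> ?S) (at a within ?S)"
        by (simp add: eventually_at_topological) (use open_UNIV in blast)
      ultimately show "eventually (\<lambda>p. \<kappa> a = \<kappa> p) (at a within ?S)"
      proof eventually_elim
        case (elim p)
        then show ?case using \<kappa>I[of p "\<kappa> a"] \<kappa>(1)[of a] a by simp
      qed
    qed
  qed
  let ?k = "\<kappa> p0"
  \<comment> \<open>With a constant index this product is one function on the whole bidisc,
    zero-free off the origin.\<close>
  have "G (0, 0) ?k * H (0, 0) (N - ?k) \<noteq> 0"
  proof (rule no_isolated_zero_bidisc[where D = "\<lambda>p. G p ?k * H p (N - ?k)", OF \<delta>(1)])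
    show "continuous_on ?B (\<lambda>p. G p ?k * H p (N - ?k))"
      by (intro continuous_intros contG contH)
    fix x :: complex assume x: "x \<in> ball 0 \<delta>"
    show "(\<lambda>y. G (x, y) ?k * H (x, y) (N - ?k)) holomorphic_on ball 0 \<delta>"
      unfolding G_def H_def
      by (intro holomorphic_intros holomorphic_on_hankel_det[OF _ F(1) r \<delta>(2) F1nz x] F) auto
  next
    fix p :: "complex \<times> complex" assume p: "p \<in> ?B" "p \<noteq> 0"
    then show "G p ?k * H p (N - ?k) \<noteq> 0"
      using \<kappa>[OF p] const[of p] by simp
  qed
  moreover have "G 0 ?k = 0 \<or> H 0 (N - ?k) = 0"
    unfolding G_def H_def
  proof (rule hankel_dets_of_vanishing_quadruple[OF r _ _ _ g(1) gnz g(3)])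
    show "F1 0 z * F4 0 z = F2 0 z * F3 0 z" if "z \<in> cball 0 r" for z
      using eq[OF origin, of z] that r by auto
    show "?k \<le> N" using \<kappa>(1)[of p0] p0 by auto
  qed (use zero hol[OF _ origin] F in auto)
  ultimately show False by (auto simp: zero_prod_def)
qed

subsection \<open>Holomorphic maps of the ball into the quadric cone\<close>

no_notation fps_nth (infixl \<open>$\<close> 75)
no_notation vec_index (infixl \<open>$\<close> 100)

lemma norm_vector_scalar_mult: "norm (t *s v) = cmod t * norm v" for v :: "complex^'n"
  by (simp add: norm_vec_def norm_mult L2_set_right_distrib)

lemma holo_fun_on_imp_continuous_on: "holo_fun_on f U \<Longrightarrow> continuous_on U f"
  unfolding holo_fun_on_def
  by (metis continuous_at_imp_continuous_on has_derivative_continuous)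

text \<open>Along a complex line, complex linearity turns the Frechet derivative into multiplication
  by \<open>D v\<close>.\<close>

lemma holomorphic_on_affine_line:
  assumes f: "holo_fun_on f U" and sub: "\<And>t. t \<in> S \<Longrightarrow> a + t *s v \<in> U"
  shows "(\<lambda>t. f (a + t *s v)) holomorphic_on S"
  unfolding holomorphic_on_def
proof
  fix t assume "t \<in> S"
  then obtain D where D: "(f has_derivative D) (at (a + t *s v))" "\<And>c v. D (c *s v) = c * D v"
    using f sub unfolding holo_fun_on_def by blast
  have "linear (\<lambda>s. s *s v)"
    by (rule linearI) (simp_all add: Finite_Cartesian_Product.vec_eq_iff algebra_simps)
  then have "bounded_linear (\<lambda>s. s *s v)" by (simp add: linear_conv_bounded_linear)
  then have "((\<lambda>t. a + t *s v) has_derivative (\<lambda>s. s *s v)) (at t)"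
    by (auto intro!: derivative_eq_intros bounded_linear_imp_has_derivative)
  from has_derivative_compose[OF this D(1)]
  have "((\<lambda>t. f (a + t *s v)) has_derivative (\<lambda>s. D v * s)) (at t)"
    by (simp add: D(2) mult.commute)
  then have "((\<lambda>t. f (a + t *s v)) has_field_derivative D v) (at t)"
    by (simp add: has_field_derivative_def)
  then show "(\<lambda>t. f (a + t *s v)) field_differentiable at t within S"
    using field_differentiable_at_within field_differentiable_def by blast
qed

text \<open>The functions are restricted to a three-dimensional slice through \<open>c\<close>,
  spanned by the direction towards \<open>q\<close> and two coordinate axes.\<close>

lemma no_isolated_zero_of_quadric_map_aux:
  fixes f1 f2 f3 f4 :: "complex^'n \<Rightarrow> complex"
  assumes n: "3 \<le> CARD('n)" and "0 < \<epsilon>"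
    and f: "holo_fun_on f1 (ball c \<epsilon>)" "holo_fun_on f2 (ball c \<epsilon>)" "holo_fun_on f3 (ball c \<epsilon>)"
      "holo_fun_on f4 (ball c \<epsilon>)"
    and eq: "\<And>x. x \<in> ball c \<epsilon> \<Longrightarrow> f1 x * f4 x = f2 x * f3 x"
    and zero: "f1 c = 0" "f2 c = 0" "f3 c = 0" "f4 c = 0"
    and isolated: "\<And>x. x \<in> ball c \<epsilon> \<Longrightarrow> x \<noteq> c \<Longrightarrow> f1 x \<noteq> 0 \<or> f2 x \<noteq> 0 \<or> f3 x \<noteq> 0 \<or> f4 x \<noteq> 0"
    and q: "q \<in> ball c \<epsilon>" "f1 q \<noteq> 0"
  shows False
proof -
  define v where "v = q - c"
  have "v \<noteq> 0" using q zero by (auto simp: v_def)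
  \<comment> \<open>Omitting the axis \<open>i\<close> from the choice of \<open>j\<close> and
    \<open>k\<close> makes \<open>v\<close> and the axes \<open>j\<close>, \<open>k\<close> linearly
    independent; three indices are required.\<close>
  then obtain i where i: "v $ i \<noteq> 0" by (metis Finite_Cartesian_Product.vec_eq_iff zero_index)
  have "card (UNIV - {i}) \<noteq> 0" using n by simp
  then have "UNIV - {i} \<noteq> {}" by force
  then obtain j where j: "j \<noteq> i" by blast
  have "card (UNIV - {i, j}) \<noteq> 0" using n j by (simp add: card_Diff_subset)
  then have "UNIV - {i, j} \<noteq> {}" by force
  then obtain k where k: "k \<noteq> i" "k \<noteq> j" by blast
  define \<rho> where "\<rho> = \<epsilon> / norm v"
  have "norm v < \<epsilon>" using q(1) by (simp add: v_def dist_norm norm_minus_commute)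
  then have \<rho>: "\<rho> > 1" using \<open>v \<noteq> 0\<close> by (simp add: \<rho>_def)
  have "c + t *s v \<in> ball c \<epsilon>" if "t \<in> ball 0 \<rho>" for t
    using that \<open>v \<noteq> 0\<close> by (simp add: dist_norm norm_vector_scalar_mult \<rho>_def pos_less_divide_eq)
  then have "(\<lambda>t. f1 (c + t *s v)) holomorphic_on ball 0 \<rho>"
    by (rule holomorphic_on_affine_line[OF f(1)])
  \<comment> \<open>On the line through \<open>q\<close> the function \<open>f1\<close> is not
    identically zero, so its zero at \<open>c\<close> is isolated. This provides the hypothesis
    \<open>regular\<close>.\<close>
  then obtain \<sigma> where \<sigma>: "0 < \<sigma>" "\<And>t. t \<in> ball 0 \<sigma> - {0} \<Longrightarrow> f1 (c + t *s v) \<noteq> 0"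
  proof (rule isolated_zeros[where \<xi> = 0 and \<beta> = 1])
    show "f1 (c + 0 *s v) = 0" "f1 (c + 1 *s v) \<noteq> 0" using zero q by (simp_all add: v_def)
  qed (use \<rho> in auto)
  define L where "L = (\<lambda>p z. c + fst p *s axis j 1 + snd p *s axis k 1 + z *s v)"
  have L_cont: "continuous_on S (\<lambda>y. L (fst y) (snd y))" for S
  proof -
    have *: "(\<lambda>y. L (fst y) (snd y)) = (\<lambda>y. \<chi> l. c $ l + fst (fst y) * axis j 1 $ l +
        snd (fst y) * axis k 1 $ l + snd y * v $ l)"
      by (simp add: L_def fun_eq_iff Finite_Cartesian_Product.vec_eq_iff)
    show ?thesis unfolding * by (intro continuous_intros)
  qed
  have "open ((\<lambda>y. L (fst y) (snd y)) -` ball c \<epsilon>)"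
    using L_cont[of UNIV] by (intro open_vimage) auto
  moreover have "(0, 0) \<in> (\<lambda>y. L (fst y) (snd y)) -` ball c \<epsilon>" using \<open>0 < \<epsilon>\<close> by (simp add: L_def)
  ultimately obtain T where T: "0 < T" "ball (0, 0) T \<subseteq> (\<lambda>y. L (fst y) (snd y)) -` ball c \<epsilon>"
    by (meson open_contains_ball)
  \<comment> \<open>A third of \<open>T\<close>, since the norm of the triple is bounded by the sum
    of three norms below \<open>R\<close>.\<close>
  define R where "R = min \<sigma> (T / 3)"
  have R: "0 < R" "R \<le> \<sigma>" "R \<le> T / 3" using \<sigma>(1) T(1) by (auto simp: R_def)
  have L_in: "L p z \<in> ball c \<epsilon>" if "p \<in> ball 0 R \<times> ball 0 R" "z \<in> ball 0 R" for p z
  proof -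
    have "norm (p, z) \<le> norm (fst p) + norm (snd p) + norm z"
      by (metis norm_Pair_le add_mono_thms_linordered_semiring(3) order_trans prod.collapse)
    also have "\<dots> < T" using that R by (auto simp: mem_Times_iff)
    finally have "(p, z) \<in> ball (0, 0) T" unfolding zero_prod_def[symmetric] by simp
    then show ?thesis using T(2) by auto
  qed
  have sep: "sep_holomorphic R (\<lambda>p z. h (L p z))" if h: "holo_fun_on h (ball c \<epsilon>)" for h
    unfolding sep_holomorphic_def
  proof (intro conjI ballI)
    show "continuous_on ((ball 0 R \<times> ball 0 R) \<times> ball 0 R) (\<lambda>(p, z). h (L p z))"
      unfolding case_prod_beta
      by (rule continuous_on_compose2[OF holo_fun_on_imp_continuous_on[OF h] L_cont])
         (use L_in in auto)
    fix p :: "complex \<times> complex" assume "p \<in> ball 0 R \<times> ball 0 R"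
    then show "(\<lambda>z. h (L p z)) holomorphic_on ball 0 R"
      using L_in unfolding L_def by (intro holomorphic_on_affine_line[OF h]) auto
  next
    fix x z :: complex assume "x \<in> ball 0 R" "z \<in> ball 0 R"
    then have "(c + x *s axis j 1 + z *s v) + y *s axis k 1 \<in> ball c \<epsilon>" if "y \<in> ball 0 R" for y
      using L_in[of "(x, y)" z] that by (simp add: L_def algebra_simps)
    then have "(\<lambda>y. h ((c + x *s axis j 1 + z *s v) + y *s axis k 1)) holomorphic_on ball 0 R"
      by (rule holomorphic_on_affine_line[OF h])
    then show "(\<lambda>y. h (L (x, y) z)) holomorphic_on ball 0 R" by (simp add: L_def algebra_simps)
  qed
  have L0: "L 0 0 = c" by (simp add: L_def)
  have L_inj: "p = 0" if "L p z = c" for p z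
  proof -
    have *: "fst p * axis j 1 $ l + snd p * axis k 1 $ l + z * v $ l = 0" for l
      using that by (auto simp: L_def Finite_Cartesian_Product.vec_eq_iff add.assoc dest!: spec[of _ l])
    have "z = 0" using *[of i] i j k by (simp add: axis_def)
    then have "fst p = 0" "snd p = 0" using *[of j] *[of k] k by (auto simp: axis_def)
    then show ?thesis by (simp add: prod_eq_iff)
  qed
  show False
  proof (rule no_isolated_zero_of_determinantal_quadruple[OF R(1) sep[OF f(1)] sep[OF f(2)]
        sep[OF f(3)] sep[OF f(4)]])
    fix p :: "complex \<times> complex" and z :: complex
    assume p: "p \<in> ball 0 R \<times> ball 0 R" "z \<in> ball 0 R"
    show "f1 (L p z) * f4 (L p z) = f2 (L p z) * f3 (L p z)" by (rule eq[OF L_in[OF p]])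
    assume "p \<noteq> 0"
    then show "f1 (L p z) \<noteq> 0 \<or> f2 (L p z) \<noteq> 0 \<or> f3 (L p z) \<noteq> 0 \<or> f4 (L p z) \<noteq> 0"
      using isolated[OF L_in[OF p]] L_inj by blast
  next
    fix z :: complex assume "z \<in> ball 0 R" "z \<noteq> 0"
    then show "f1 (L 0 z) \<noteq> 0" using \<sigma>(2)[of z] R(2) by (simp add: L_def)
  qed (simp_all add: L0 zero)
qed

text \<open>Some coordinate is nonzero at a point near \<open>c\<close>, and a symmetry of the
  equation moves it to the first place.\<close>

lemma no_isolated_zero_of_quadric_map:
  fixes f1 f2 f3 f4 :: "complex^'n \<Rightarrow> complex"
  assumes n: "3 \<le> CARD('n)" and "0 < \<epsilon>"
    and f: "holo_fun_on f1 (ball c \<epsilon>)" "holo_fun_on f2 (ball c \<epsilon>)" "holo_fun_on f3 (ball c \<epsilon>)"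
      "holo_fun_on f4 (ball c \<epsilon>)"
    and eq: "\<And>x. x \<in> ball c \<epsilon> \<Longrightarrow> f1 x * f4 x = f2 x * f3 x"
    and zero: "f1 c = 0" "f2 c = 0" "f3 c = 0" "f4 c = 0"
    and isolated: "\<And>x. x \<in> ball c \<epsilon> \<Longrightarrow> x \<noteq> c \<Longrightarrow> f1 x \<noteq> 0 \<or> f2 x \<noteq> 0 \<or> f3 x \<noteq> 0 \<or> f4 x \<noteq> 0"
  shows False
proof -
  define e :: "complex^'n" where "e = (\<chi> i. 1)"
  have "e \<noteq> 0" by (simp add: e_def Finite_Cartesian_Product.vec_eq_iff)
  \<comment> \<open>Any point of the ball other than \<open>c\<close> serves; this one has distance
    \<open>\<epsilon> / 2\<close> from \<open>c\<close>.\<close>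
  define q where "q = c + of_real (\<epsilon> / (2 * norm e)) *s e"
  have "norm (q - c) = cmod (of_real (\<epsilon> / (2 * norm e))) * norm e"
    by (simp only: q_def norm_vector_scalar_mult add_diff_cancel_left')
  also have "\<dots> = \<epsilon> / 2" using \<open>e \<noteq> 0\<close> \<open>0 < \<epsilon>\<close> by (simp only: norm_of_real) simp
  finally have "norm (q - c) = \<epsilon> / 2" .
  then have q: "q \<in> ball c \<epsilon>" "q \<noteq> c" using \<open>0 < \<epsilon>\<close> by (auto simp: dist_norm norm_minus_commute)
  note aux = no_isolated_zero_of_quadric_map_aux[OF n \<open>0 < \<epsilon>\<close> _ _ _ _ _ _ _ _ _ _ q(1)]
  from isolated[OF q] consider "f1 q \<noteq> 0" | "f2 q \<noteq> 0" | "f3 q \<noteq> 0" | "f4 q \<noteq> 0" by blast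
  then show False
  proof cases
    case 1
    show False by (rule aux[of f1 f2 f3 f4]) (use 1 f eq zero isolated in auto)
  next
    case 2
    show False by (rule aux[of f2 f1 f4 f3]) (use 2 f eq zero isolated in auto)
  next
    case 3
    show False by (rule aux[of f3 f1 f4 f2]) (use 3 f eq zero isolated in \<open>auto simp: mult.commute\<close>)
  next
    case 4
    show False by (rule aux[of f4 f2 f3 f1]) (use 4 f eq zero isolated in \<open>auto simp: mult.commute\<close>)
  qed
qed

section \<open>Dimension and finite fibres of the map from the ball\<close>

lemma three_le_card_if_holo_map_onto_cone_domain:
  fixes f :: "complex^'n \<Rightarrow> complex^4"
  assumes f: "holo_map_on f unit_ball" and onto: "cone_domain \<subseteq> f ` unit_ball"
  shows "3 \<le> CARD('n)"
proof (rule ccontr)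
  assume "\<not> 3 \<le> CARD('n)"
  then have dim: "DIM(complex^'n) < DIM(complex^3)" by simp
  define g :: "complex^4 \<Rightarrow> complex^3" where
    "g w = (\<chi> i. if i = 1 then w $ 1 else if i = 2 then w $ 2 else w $ 3)" for w
  have "linear g"
    by (rule linearI) (simp_all add: g_def Finite_Cartesian_Product.vec_eq_iff)
  then have g: "bounded_linear g" by (simp add: linear_conv_bounded_linear)
  have "(\<lambda>z. g (f z)) differentiable_on unit_ball"
    unfolding differentiable_on_def
  proof
    fix x :: "complex^'n" assume "x \<in> unit_ball"
    then obtain D where "(f has_derivative D) (at x)" using f unfolding holo_map_on_def by blast
    then have "((\<lambda>z. g (f z)) has_derivative (\<lambda>v. g (D v))) (at x)"
      by (rule bounded_linear.has_derivative[OF g])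
    then show "(\<lambda>z. g (f z)) differentiable at x within unit_ball"
      using differentiable_at_withinI differentiable_def by blast
  qed
  \<comment> \<open>A differentiable map out of a space of smaller real dimension has a null image,
    whereas the projected cone domain contains a nonempty open set.\<close>
  then have negl: "negligible ((\<lambda>z. g (f z)) ` unit_ball)"
    by (rule negligible_differentiable_image_lowdim[OF dim])
  \<comment> \<open>The norm condition for \<open>(x1, x2, x3, x2 x3 / x1)\<close>, multiplied by
    the squared modulus of \<open>x1\<close>. The strict inequality also forces \<open>x1\<close> to
    be nonzero.\<close>
  define O' :: "(complex^3) set" where "O' = {x.
    (cmod (x $ 1))\<^sup>2 * ((cmod (x $ 1))\<^sup>2 + (cmod (x $ 2))\<^sup>2 + (cmod (x $ 3))\<^sup>2) + (cmod (x $ 2 * x $ 3))\<^sup>2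
      < (cmod (x $ 1))\<^sup>2}"
  have "open O'" unfolding O'_def by (intro open_Collect_less continuous_intros)
  moreover have "(\<chi> i. if i = 1 then 1 / 2 else 0) \<in> O'" by (simp add: O'_def power2_eq_square)
  then have "O' \<noteq> {}" by blast
  ultimately have "\<not> negligible O'" by (rule open_not_negligible)
  moreover have "O' \<subseteq> (\<lambda>z. g (f z)) ` unit_ball"
  proof
    fix x assume x: "x \<in> O'"
    then have x1: "x $ 1 \<noteq> 0" by (auto simp: O'_def)
    define w :: "complex^4" where
      "w = (\<chi> i. if i = 1 then x $ 1 else if i = 2 then x $ 2 else if i = 3 then x $ 3 else x $ 2 * x $ 3 / x $ 1)"
    have w: "w $ 1 = x $ 1" "w $ 2 = x $ 2" "w $ 3 = x $ 3" "w $ 4 = x $ 2 * x $ 3 / x $ 1"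
      by (simp_all add: w_def)
    let ?a = "(cmod (x $ 1))\<^sup>2" and ?s = "(cmod (x $ 1))\<^sup>2 + (cmod (x $ 2))\<^sup>2 + (cmod (x $ 3))\<^sup>2"
      and ?b = "(cmod (x $ 2 * x $ 3))\<^sup>2"
    have "?a > 0" using x1 by simp
    have "?a * ?s + ?b < ?a" using x by (simp add: O'_def)
    then have "?b < (1 - ?s) * ?a" by (simp add: algebra_simps)
    then have "?b / ?a < 1 - ?s" by (rule mult_imp_div_pos_less[OF \<open>?a > 0\<close>])
    then have "?s + ?b / ?a < 1" by linarith
    then have "w \<in> cone_domain"
      using x1 by (simp add: cone_domain_def w norm_divide power_divide)
    then obtain z where "z \<in> unit_ball" "f z = w" using onto by blast
    moreover have "g w = x"
      by (simp add: g_def w Finite_Cartesian_Product.vec_eq_iff) (metis exhaust_3)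
    ultimately show "x \<in> (\<lambda>z. g (f z)) ` unit_ball" by force
  qed
  ultimately show False using negl negligible_subset by blast
qed

text \<open>Composing \<open>\<psi>\<close> with the orbit map pulls the coordinate functions back
  to holomorphic functions on the ball. As \<open>\<psi>\<close> is injective on orbits, each
  nonempty fibre is a single orbit of the finite group.\<close>

lemma biholomorphic_ball_quotient_imp_holo_map:
  fixes \<Gamma> :: "(complex^'n \<Rightarrow> complex^'n) set"
  assumes \<Gamma>: "subgroup \<Gamma> (HolAut unit_ball)" "finite \<Gamma>"
    and bih: "biholomorphic (embedded_space A) (ball_quotient \<Gamma>)"
  obtains f :: "complex^'n \<Rightarrow> complex^'m" where "holo_map_on f unit_ball" "f ` unit_ball = A"
    "\<And>a. finite {z \<in> unit_ball. f z = a}"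
proof -
  obtain \<phi> \<psi> where \<phi>: "holomorphic_map (embedded_space A) (ball_quotient \<Gamma>) \<phi>"
    and \<psi>: "holomorphic_map (ball_quotient \<Gamma>) (embedded_space A) \<psi>"
    and \<psi>\<phi>: "\<And>x. x \<in> A \<Longrightarrow> \<psi> (\<phi> x) = x" and \<phi>\<psi>: "\<And>y. y \<in> ball_orbits \<Gamma> \<Longrightarrow> \<phi> (\<psi> y) = y"
    using bih unfolding biholomorphic_def
    by (auto simp: embedded_space_def ball_quotient_def topspace_ball_quotient_topology)
  have orbits: "ball_orbits \<Gamma> = ball_orbit \<Gamma> ` unit_ball"
    by (auto simp: ball_orbits_def ball_orbit_def orbits_def)
  have \<phi>_in: "\<phi> x \<in> ball_orbits \<Gamma>" if "x \<in> A" for x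
    using \<phi> that unfolding holomorphic_map_def continuous_map_def
    by (auto simp: embedded_space_def ball_quotient_def topspace_ball_quotient_topology)
  have \<psi>_in: "\<psi> y \<in> A" if "y \<in> ball_orbits \<Gamma>" for y
    using \<psi> that unfolding holomorphic_map_def continuous_map_def
    by (auto simp: embedded_space_def ball_quotient_def topspace_ball_quotient_topology)
  define f where "f = (\<lambda>z. \<psi> (ball_orbit \<Gamma> z))"
  show thesis
  proof
    show "holo_map_on f unit_ball"
      unfolding holo_map_on_iff_components
    proof
      fix i
      have "holo_fun_on (\<lambda>w :: complex^'m. w $ i) UNIV"
        unfolding holo_fun_on_def
        using bounded_linear_vec_nth[of i]
        by (auto intro!: exI[of _ "\<lambda>w. w $ i"] bounded_linear_imp_has_derivative)
      then have "(\<lambda>w. w $ i) \<in> hol_funs (embedded_space A) A"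
        unfolding embedded_space_def by (auto intro!: exI[of _ UNIV])
      moreover have "openin (space_top (embedded_space A)) A"
        by (simp add: embedded_space_def)
      ultimately have "(\<lambda>y. \<psi> y $ i) \<in> hol_funs (ball_quotient \<Gamma>)
          {y \<in> topspace (space_top (ball_quotient \<Gamma>)). \<psi> y \<in> A}"
        using \<psi> unfolding holomorphic_map_def by blast
      moreover have "{z \<in> unit_ball. ball_orbit \<Gamma> z \<in> {y \<in> ball_orbits \<Gamma>. \<psi> y \<in> A}} = unit_ball"
        using orbits \<psi>_in by auto
      ultimately show "holo_fun_on (\<lambda>z. f z $ i) unit_ball"
        by (simp add: ball_quotient_def topspace_ball_quotient_topology f_def)
    qed
    show "f ` unit_ball = A"
    proof
      show "f ` unit_ball \<subseteq> A" using \<psi>_in orbits by (auto simp: f_def)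
      show "A \<subseteq> f ` unit_ball"
      proof
        fix x assume x: "x \<in> A"
        then obtain z where "z \<in> unit_ball" "\<phi> x = ball_orbit \<Gamma> z" using \<phi>_in orbits by blast
        then show "x \<in> f ` unit_ball" using \<psi>\<phi>[OF x] by (auto simp: f_def)
      qed
    qed
    fix a
    interpret group_action "(HolAut unit_ball)\<lparr>carrier := \<Gamma>\<rparr>" unit_ball "\<lambda>g. g"
      by (rule group_action_HolAut[OF open_ball \<Gamma>(1)])
    have orbit: "ball_orbit \<Gamma> z = (\<lambda>g. g z) ` \<Gamma>" for z
      by (auto simp: ball_orbit_def orbit_def)
    have "{z \<in> unit_ball. f z = a} \<subseteq> (\<lambda>g. g z0) ` \<Gamma>" if z0: "z0 \<in> unit_ball" "f z0 = a" for z0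
    proof
      fix z assume z: "z \<in> {z \<in> unit_ball. f z = a}"
      have "ball_orbit \<Gamma> z = \<phi> (\<psi> (ball_orbit \<Gamma> z))" using \<phi>\<psi> orbits z by auto
      also have "\<dots> = \<phi> (\<psi> (ball_orbit \<Gamma> z0))" using z z0(2) by (simp add: f_def)
      also have "\<dots> = ball_orbit \<Gamma> z0" using \<phi>\<psi> orbits z0(1) by auto
      finally have "ball_orbit \<Gamma> z = ball_orbit \<Gamma> z0" .
      moreover have "z \<in> ball_orbit \<Gamma> z" using orbit_refl z unfolding ball_orbit_def by blast
      ultimately show "z \<in> (\<lambda>g. g z0) ` \<Gamma>" using orbit by blast
    qed
    then show "finite {z \<in> unit_ball. f z = a}"
      using \<Gamma>(2) by (metis (mono_tags, lifting) empty_Collect_eq finite.emptyI finite_imageI finite_subset)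
  qed
qed

theorem proposition6p4:
  fixes \<Gamma> :: "(complex^'n \<Rightarrow> complex^'n) set"
  assumes "subgroup \<Gamma> (HolAut unit_ball)"
    and "finite \<Gamma>"
  shows "\<not> biholomorphic (embedded_space cone_domain) (ball_quotient \<Gamma>)"
proof
  assume "biholomorphic (embedded_space cone_domain) (ball_quotient \<Gamma>)"
  then obtain f :: "complex^'n \<Rightarrow> complex^4" where f: "holo_map_on f unit_ball"
    and onto: "f ` unit_ball = cone_domain" and fin: "\<And>a. finite {z \<in> unit_ball. f z = a}"
    by (rule biholomorphic_ball_quotient_imp_holo_map[OF assms])
       (rule that, assumption, assumption, blast)
  have "0 \<in> cone_domain" by (simp add: cone_domain_def)
  then obtain c where c: "c \<in> unit_ball" "f c = 0" using onto by (metis imageE)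
  \<comment> \<open>The fibre over the vertex is finite, so \<open>c\<close> has a neighbourhood in
    which it is the only zero of \<open>f\<close>.\<close>
  have "open (unit_ball - ({z \<in> unit_ball. f z = 0} - {c}))"
    using fin[of 0] by (intro open_Diff finite_imp_closed) auto
  moreover have "c \<in> unit_ball - ({z \<in> unit_ball. f z = 0} - {c})" using c by simp
  ultimately obtain \<epsilon> where \<epsilon>: "0 < \<epsilon>" "ball c \<epsilon> \<subseteq> unit_ball - ({z \<in> unit_ball. f z = 0} - {c})"
    by (meson open_contains_ball)
  have sub: "ball c \<epsilon> \<subseteq> unit_ball" using \<epsilon>(2) by blast
  have holo: "holo_fun_on (\<lambda>z. f z $ i) (ball c \<epsilon>)" for i
    using f sub unfolding holo_map_on_iff_components holo_fun_on_def by blast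
  show False
  proof (rule no_isolated_zero_of_quadric_map[OF _ \<epsilon>(1) holo[of 1] holo[of 2] holo[of 3] holo[of 4]])
    show "3 \<le> CARD('n)"
      by (rule three_le_card_if_holo_map_onto_cone_domain[OF f]) (simp add: onto)
    fix x assume x: "x \<in> ball c \<epsilon>"
    then have "f x \<in> cone_domain" using sub onto by blast
    then show "f x $ 1 * f x $ 4 = f x $ 2 * f x $ 3" by (simp add: cone_domain_def)
    assume "x \<noteq> c"
    then have "f x \<noteq> 0" using x \<epsilon>(2) by blast
    then show "f x $ 1 \<noteq> 0 \<or> f x $ 2 \<noteq> 0 \<or> f x $ 3 \<noteq> 0 \<or> f x $ 4 \<noteq> 0"
      by (auto simp: Finite_Cartesian_Product.vec_eq_iff forall_4)
  qed (simp_all add: c)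
qed

end
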